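(* Let $\tau:M\to M_0$ be a fibration of smooth real Banach manifolds, and let $N:TM\to TM$ be an $\mathcal N$-operator on $M$ which is projectable onto an $\mathcal N$-operator $N_0:TM_0\to TM_0$ on $M_0$. Then $N_0$ is a Nijenhuis operator (i.e. $\mathcal T_{N_0}=0$) if and only if the Nijenhuis torsion $\mathcal T_N$ of $N$ is vertical, i.e. $T\tau\circ\mathcal T_N=0$.
   Context: All manifolds are smooth ($C^\infty$) real Banach manifolds, possibly infinite-dimensional. A vector bundle morphism between Banach vector bundles is a smooth fibre-preserving map that is bounded linear on fibres; locally, for trivial bundles $E\times F$ and $E'\times F'$, it has the form $\Phi(p,y)=(\Phi_0(p),\Phi_p(y))$ with $\Phi_0$ smooth and $\Phi_p\in B(F,F')$ a bounded linear operator. An $\mathcal N$-operator on a Banach manifold $M$ is a vector bundle morphism $N:TM\to TM$ covering the identity on $M$. If $M$ is modelled on a Banach space $E$, then locally $TM=E\times E$, vector fields are smooth maps $X:E\to E$, and $N$ is interpreted as a smooth map $E\to B(E)$, where $B(E)$ denotes the bounded linear operators on $E$. The Lie bracket of (local) vector fields is given locally by $[X,Y]_p=D_pX(Y_p)-D_pY(X_p)$ (the overall sign convention does not affect the statement). The Nijenhuis torsion of $N$ is defined on local vector fields by $$\mathcal T_N(X,Y)=[NX,NY]-N\big([NX,Y]+[X,NY]-N[X,Y]\big).$$ It is known that $\mathcal T_N(X,Y)_p$ depends only on $X_p,Y_p$, so $\mathcal T_N$ is a tensor, given at each $p\in M$ by a bounded skew-symmetric bilinear map $(\mathcal T_N)_p:T_pM\times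 T_pM\to T_pM$. All definitions are local: only local vector fields are used, and global ones need not exist. $N$ is called a Nijenhuis operator if $\mathcal T_N=0$. A fibration $\tau:M\to M_0$ is a smooth surjective submersion of Banach manifolds: each $T_m\tau:T_mM\to T_{\tau(m)}M_0$ is surjective; the kernel of $T_m\tau$ is not assumed to admit a complementary Banach subspace. The vertical subbundle is $\mathsf V=\ker(T\tau)\subset TM$. An $\mathcal N$-operator $N$ on $M$ is projectable onto an $\mathcal N$-operator $N_0$ on $M_0$ if $N_0\circ T\tau=T\tau\circ N$. *)

theory Defs
  imports "HOL-Analysis.Analysis"
begin

section \<open>Smooth maps between Banach spaces\<close>

text \<open>
  A continuous \<open>n\<close>-linear map from \<open>'a\<close> to \<open>'b\<close> is a function on lists, of which only the values on
  lists of length \<open>n\<close> matter. In this way all the spaces of continuous \<open>n\<close>-linear maps share one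
  type.
\<close>

definition bounded_multilinear ::
    "nat \<Rightarrow> ('a::real_normed_vector list \<Rightarrow> 'b::real_normed_vector) \<Rightarrow> bool" where
  "bounded_multilinear n T \<longleftrightarrow>
     (\<forall>us ws. length us + length ws + 1 = n \<longrightarrow> linear (\<lambda>v. T (us @ v # ws))) \<and>
     (\<exists>K. \<forall>vs. length vs = n \<longrightarrow> norm (T vs) \<le> K * prod_list (map norm vs))"

text \<open>
  \<open>f\<close> is of class \<open>C\<^sup>\<infinity>\<close> on the open set \<open>S\<close> if it has Frechet derivatives of all orders there:
  \<open>D n x\<close> is the \<open>n\<close>-th derivative at \<open>x\<close>, and the last conjunct says that
  \<open>x \<mapsto> D n x\<close> is Frechet differentiable for the operator norm on continuous \<open>n\<close>-linear maps, with
  derivative \<open>h \<mapsto> D (Suc n) x (h, \<dots>)\<close>.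
\<close>

definition smooth_on ::
    "'a::real_normed_vector set \<Rightarrow> ('a \<Rightarrow> 'b::real_normed_vector) \<Rightarrow> bool" where
  "smooth_on S f \<longleftrightarrow> open S \<and>
     (\<exists>D :: nat \<Rightarrow> 'a \<Rightarrow> 'a list \<Rightarrow> 'b.
        (\<forall>x\<in>S. D 0 x [] = f x) \<and>
        (\<forall>n. \<forall>x\<in>S. bounded_multilinear n (D n x)) \<and>
        (\<forall>n. \<forall>x\<in>S. \<forall>\<epsilon>>0. \<forall>\<^sub>F y in at x. \<forall>vs. length vs = n \<longrightarrow>
           norm (D n y vs - D n x vs - D (Suc n) x ((y - x) # vs))
             \<le> \<epsilon> * norm (y - x) * prod_list (map norm vs)))"


section \<open>Banach manifolds\<close>

text \<open>
  Manifolds are given by an atlas in the sense of Lang: a chart is a pair of its domain and its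
  coordinate map, and neither the points nor the topology are separate data. The point set is the
  union of the chart domains; the topology is the one that makes all charts homeomorphisms.
\<close>

type_synonym ('m, 'e) chart = "'m set \<times> ('m \<Rightarrow> 'e)"

abbreviation chart_dom :: "('m, 'e) chart \<Rightarrow> 'm set" where
  "chart_dom c \<equiv> fst c"

abbreviation coord :: "('m, 'e) chart \<Rightarrow> 'm \<Rightarrow> 'e" where
  "coord c \<equiv> snd c"

abbreviation inv_coord :: "('m, 'e) chart \<Rightarrow> 'e \<Rightarrow> 'm" where
  "inv_coord c \<equiv> inv_into (chart_dom c) (coord c)"

definition points :: "('m, 'e) chart set \<Rightarrow> 'm set" where
  "points A = (\<Union>c\<in>A. chart_dom c)"

definition banach_manifold :: "('m, 'e::banach) chart set \<Rightarrow> bool" where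
  "banach_manifold A \<longleftrightarrow>
     (\<forall>c\<in>A. inj_on (coord c) (chart_dom c) \<and> open (coord c ` chart_dom c)) \<and>
     (\<forall>c\<in>A. \<forall>d\<in>A. open (coord c ` (chart_dom c \<inter> chart_dom d)) \<and>
        smooth_on (coord c ` (chart_dom c \<inter> chart_dom d)) (coord d \<circ> inv_coord c))"

definition mfd_open :: "('m, 'e::banach) chart set \<Rightarrow> 'm set \<Rightarrow> bool" where
  "mfd_open A U \<longleftrightarrow> U \<subseteq> points A \<and> (\<forall>c\<in>A. open (coord c ` (U \<inter> chart_dom c)))"

text \<open>Openness of the domains of the local representatives expresses continuity.\<close>

definition smooth_map ::
    "('m, 'e::banach) chart set \<Rightarrow> ('n, 'f::banach) chart set \<Rightarrow> ('m \<Rightarrow> 'n) \<Rightarrow> bool" where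
  "smooth_map A B f \<longleftrightarrow>
     f ` points A \<subseteq> points B \<and>
     (\<forall>c\<in>A. \<forall>d\<in>B.
        open (coord c ` {p \<in> chart_dom c. f p \<in> chart_dom d}) \<and>
        smooth_on (coord c ` {p \<in> chart_dom c. f p \<in> chart_dom d}) (coord d \<circ> f \<circ> inv_coord c))"


section \<open>The tangent bundle\<close>

text \<open>
  A tangent vector is an equivalence class of triples \<open>(c, p, v)\<close>, where \<open>c\<close> is a chart around \<open>p\<close>
  and \<open>v\<close> is a vector of the model space; two triples at \<open>p\<close> are equivalent if the derivative
  of the transition map takes one vector to the other. A class contains exactly one
  triple for every chart around \<open>p\<close>.
\<close>

type_synonym ('m, 'e) tvec = "(('m, 'e) chart \<times> 'm \<times> 'e) set"

definition tangent_rel ::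
    "('m, 'e::banach) chart set \<Rightarrow> (('m, 'e) chart \<times> 'm \<times> 'e) rel" where
  "tangent_rel A =
     {((c, p, v), (d, p, w)) | c d p v w.
        c \<in> A \<and> d \<in> A \<and> p \<in> chart_dom c \<and> p \<in> chart_dom d \<and>
        w = frechet_derivative (coord d \<circ> inv_coord c) (at (coord c p)) v}"

definition tangent_vec ::
    "('m, 'e::banach) chart set \<Rightarrow> ('m, 'e) chart \<Rightarrow> 'm \<Rightarrow> 'e \<Rightarrow> ('m, 'e) tvec" where
  "tangent_vec A c p v = tangent_rel A `` {(c, p, v)}"

definition tangent_space ::
    "('m, 'e::banach) chart set \<Rightarrow> 'm \<Rightarrow> ('m, 'e) tvec set" where
  "tangent_space A p = {tangent_vec A c p v | c v. c \<in> A \<and> p \<in> chart_dom c}"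

definition tangent_bundle :: "('m, 'e::banach) chart set \<Rightarrow> ('m, 'e) tvec set" where
  "tangent_bundle A = (\<Union>p\<in>points A. tangent_space A p)"

definition component :: "('m, 'e) chart \<Rightarrow> ('m, 'e) tvec \<Rightarrow> 'e" where
  "component c \<xi> = (THE v. \<exists>p. (c, p, v) \<in> \<xi>)"

definition base_point :: "('m, 'e) tvec \<Rightarrow> 'm" where
  "base_point \<xi> = (THE p. \<exists>c v. (c, p, v) \<in> \<xi>)"

definition tangent_chart ::
    "('m, 'e::banach) chart set \<Rightarrow> ('m, 'e) chart \<Rightarrow> (('m, 'e) tvec, 'e \<times> 'e) chart" where
  "tangent_chart A c =
     ((\<Union>p\<in>chart_dom c. tangent_space A p), \<lambda>\<xi>. (coord c (base_point \<xi>), component c \<xi>))"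

definition tangent_atlas ::
    "('m, 'e::banach) chart set \<Rightarrow> (('m, 'e) tvec, 'e \<times> 'e) chart set" where
  "tangent_atlas A = tangent_chart A ` A"

text \<open>The vector space operations of the tangent spaces, carried out in every chart.\<close>

definition tv_zero :: "('m, 'e::banach) chart set \<Rightarrow> 'm \<Rightarrow> ('m, 'e) tvec" where
  "tv_zero A p = {(c, p, 0) | c. c \<in> A \<and> p \<in> chart_dom c}"

definition tv_add :: "('m, 'e::banach) tvec \<Rightarrow> ('m, 'e) tvec \<Rightarrow> ('m, 'e) tvec" where
  "tv_add \<xi> \<eta> = {(c, p, v + w) | c p v w. (c, p, v) \<in> \<xi> \<and> (c, p, w) \<in> \<eta>}"

definition tv_diff :: "('m, 'e::banach) tvec \<Rightarrow> ('m, 'e) tvec \<Rightarrow> ('m, 'e) tvec" where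
  "tv_diff \<xi> \<eta> = {(c, p, v - w) | c p v w. (c, p, v) \<in> \<xi> \<and> (c, p, w) \<in> \<eta>}"

definition tangent_map ::
    "('n, 'f::banach) chart set \<Rightarrow> ('m \<Rightarrow> 'n) \<Rightarrow> ('m, 'e::banach) tvec \<Rightarrow> ('n, 'f) tvec" where
  "tangent_map B f \<xi> =
     {(d, f p, frechet_derivative (coord d \<circ> f \<circ> inv_coord c) (at (coord c p)) v) | c d p v.
        (c, p, v) \<in> \<xi> \<and> d \<in> B \<and> f p \<in> chart_dom d}"

text \<open>Fibrations are submersions whose kernels need not be complemented.\<close>

definition fibration ::
    "('m, 'e::banach) chart set \<Rightarrow> ('n, 'f::banach) chart set \<Rightarrow> ('m \<Rightarrow> 'n) \<Rightarrow> bool" where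
  "fibration A B \<tau> \<longleftrightarrow>
     smooth_map A B \<tau> \<and> \<tau> ` points A = points B \<and>
     (\<forall>p\<in>points A. tangent_map B \<tau> ` tangent_space A p = tangent_space B (\<tau> p))"

definition vertical_bundle ::
    "('m, 'e::banach) chart set \<Rightarrow> ('n, 'f::banach) chart set \<Rightarrow> ('m \<Rightarrow> 'n) \<Rightarrow> ('m, 'e) tvec set" where
  "vertical_bundle A B \<tau> =
     {\<xi> \<in> tangent_bundle A. tangent_map B \<tau> \<xi> = tv_zero B (\<tau> (base_point \<xi>))}"


section \<open>N-operators and their Nijenhuis torsion\<close>

text \<open>Vector bundle morphisms \<open>TM \<rightarrow> TM\<close> over the identity.\<close>

definition N_operator ::
    "('m, 'e::banach) chart set \<Rightarrow> (('m, 'e) tvec \<Rightarrow> ('m, 'e) tvec) \<Rightarrow> bool" where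
  "N_operator A N \<longleftrightarrow>
     smooth_map (tangent_atlas A) (tangent_atlas A) N \<and>
     (\<forall>p\<in>points A. N ` tangent_space A p \<subseteq> tangent_space A p) \<and>
     (\<forall>c\<in>A. \<forall>p\<in>chart_dom c. bounded_linear (\<lambda>v. component c (N (tangent_vec A c p v))))"

definition projectable ::
    "('m, 'e::banach) chart set \<Rightarrow> ('n, 'f::banach) chart set \<Rightarrow> ('m \<Rightarrow> 'n) \<Rightarrow>
     (('m, 'e) tvec \<Rightarrow> ('m, 'e) tvec) \<Rightarrow> (('n, 'f) tvec \<Rightarrow> ('n, 'f) tvec) \<Rightarrow> bool" where
  "projectable A B \<tau> N N\<^sub>0 \<longleftrightarrow>
     (\<forall>\<xi>\<in>tangent_bundle A. N\<^sub>0 (tangent_map B \<tau> \<xi>) = tangent_map B \<tau> (N \<xi>))"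

definition local_rep ::
    "('m, 'e::banach) chart \<Rightarrow> ('m \<Rightarrow> ('m, 'e) tvec) \<Rightarrow> 'e \<Rightarrow> 'e" where
  "local_rep c X = (\<lambda>x. component c (X (inv_coord c x)))"

text \<open>
  Smoothness of a local vector field is required in one chart around each point of its domain; since
  transition maps are smooth it then holds in all charts.
\<close>

definition local_vector_field ::
    "('m, 'e::banach) chart set \<Rightarrow> 'm set \<Rightarrow> ('m \<Rightarrow> ('m, 'e) tvec) \<Rightarrow> bool" where
  "local_vector_field A U X \<longleftrightarrow>
     mfd_open A U \<and> (\<forall>p\<in>U. X p \<in> tangent_space A p) \<and>
     (\<forall>p\<in>U. \<exists>c\<in>A. p \<in> chart_dom c \<and> smooth_on (coord c ` (U \<inter> chart_dom c)) (local_rep c X))"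

text \<open>The value at \<open>p\<close> of the bracket, given by the local formula in every chart around \<open>p\<close>.\<close>

definition lie_bracket ::
    "('m, 'e::banach) chart set \<Rightarrow> ('m \<Rightarrow> ('m, 'e) tvec) \<Rightarrow> ('m \<Rightarrow> ('m, 'e) tvec) \<Rightarrow>
     'm \<Rightarrow> ('m, 'e) tvec" where
  "lie_bracket A X Y p =
     {(c, p,
       frechet_derivative (local_rep c X) (at (coord c p)) (local_rep c Y (coord c p)) -
       frechet_derivative (local_rep c Y) (at (coord c p)) (local_rep c X (coord c p)))
      | c. c \<in> A \<and> p \<in> chart_dom c}"

definition nijenhuis_torsion ::
    "('m, 'e::banach) chart set \<Rightarrow> (('m, 'e) tvec \<Rightarrow> ('m, 'e) tvec) \<Rightarrow>
     ('m \<Rightarrow> ('m, 'e) tvec) \<Rightarrow> ('m \<Rightarrow> ('m, 'e) tvec) \<Rightarrow> 'm \<Rightarrow> ('m, 'e) tvec" where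
  "nijenhuis_torsion A N X Y p =
     tv_diff (lie_bracket A (N \<circ> X) (N \<circ> Y) p)
       (N (tv_diff (tv_add (lie_bracket A (N \<circ> X) Y p) (lie_bracket A X (N \<circ> Y) p))
                   (N (lie_bracket A X Y p))))"

definition nijenhuis_operator ::
    "('m, 'e::banach) chart set \<Rightarrow> (('m, 'e) tvec \<Rightarrow> ('m, 'e) tvec) \<Rightarrow> bool" where
  "nijenhuis_operator A N \<longleftrightarrow> N_operator A N \<and>
     (\<forall>U X Y. local_vector_field A U X \<and> local_vector_field A U Y \<longrightarrow>
        (\<forall>p\<in>U. nijenhuis_torsion A N X Y p = tv_zero A p))"

definition vertical_torsion ::
    "('m, 'e::banach) chart set \<Rightarrow> ('n, 'f::banach) chart set \<Rightarrow> ('m \<Rightarrow> 'n) \<Rightarrow>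
     (('m, 'e) tvec \<Rightarrow> ('m, 'e) tvec) \<Rightarrow> bool" where
  "vertical_torsion A B \<tau> N \<longleftrightarrow>
     (\<forall>U X Y. local_vector_field A U X \<and> local_vector_field A U Y \<longrightarrow>
        (\<forall>p\<in>U. nijenhuis_torsion A N X Y p \<in> vertical_bundle A B \<tau>))"

end

theory Submission
  imports Defs
begin

text \<open>
  In a chart the torsion of \<open>N\<close> evaluated on vector fields contains no derivatives of the fields: at a
  point it is a bilinear expression in their values, built from the local representative \<open>n\<close> of \<open>N\<close> and
  its derivative in the base direction (\<open>torsion_rep_eq\<close>). Let \<open>f\<close> be \<open>\<tau>\<close> in charts. Projectability
  says \<open>n0 (f y, Df(y) v) = Df(y) n (y, v)\<close>. Differentiating this identity in \<open>y\<close> expresses the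
  image under \<open>Df\<close> of the derivative of \<open>n\<close> by the derivative of \<open>n0\<close> and the second derivative of \<open>f\<close>.
  In the torsion the second derivatives of \<open>f\<close> occur in pairs that cancel by symmetry, and what is left
  is \<open>T\<tau> (T\<^sub>N (u, v)) = T\<^sub>N\<^sub>0 (T\<tau> u, T\<tau> v)\<close> for tangent vectors \<open>u\<close>, \<open>v\<close> at the same point
  (\<open>torsion_rep_projects\<close>, \<open>torsion_projects\<close>).

  The equivalence follows from this formula. If \<open>T\<^sub>N\<^sub>0 = 0\<close>, then \<open>T\<tau> \<circ> T\<^sub>N = 0\<close>. Conversely, any two
  tangent vectors at a point of the base are images of tangent vectors \<open>u\<close>, \<open>v\<close> at one point above it, since
  \<open>\<tau>\<close> is a surjective submersion, and their torsion is \<open>T\<tau> (T\<^sub>N (u, v)) = 0\<close>. Because the torsion depends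
  only on values at the point, it is enough to lift single vectors; they are extended to fields that are
  constant in a chart (\<open>constant_field\<close>) and need not be related to the fields on the base elsewhere.

  Transferring the computation to manifolds requires that the bracket of local vector fields, which is
  defined by the local formula in each chart separately, is a tangent vector
  (\<open>lie_bracket_in_space\<close>). This again is a cancellation of second derivatives, now of a transition map.
\<close>

section \<open>Symmetry of the second derivative\<close>

text \<open>
  The mean value inequality is applied on \<open>{0..t}\<close> to \<open>s \<mapsto> f (x + tu + sv) - f (x + sv)\<close>, corrected by
  the linear term \<open>st G u v\<close>: the derivative of the difference is
  \<open>(F (x + tu + sv) - F (x + sv)) v\<close>, which by differentiability of \<open>F\<close> at \<open>x\<close> is close to
  \<open>t G u v\<close>. The second difference on the left is symmetric in \<open>u\<close> and \<open>v\<close>, while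
  \<open>G u v\<close> is not obviously so; this is what the symmetry of the second derivative rests on.
\<close>

lemma second_difference_bound:
  fixes f :: "'a::real_normed_vector \<Rightarrow> 'b::real_normed_vector" and F :: "'a \<Rightarrow> 'a \<Rightarrow>\<^sub>L 'b"
  assumes f: "\<And>y. norm (y - x) < \<delta> \<Longrightarrow> (f has_derivative F y) (at y)"
    and F: "\<And>y. norm (y - x) < \<delta> \<Longrightarrow> norm (F y - F x - G (y - x)) \<le> \<epsilon> * norm (y - x)"
    and G: "linear G" and t: "0 < t" "t * (norm u + norm v) < \<delta>" and \<epsilon>: "0 \<le> \<epsilon>"
  shows "norm (f (x + t *\<^sub>R u + t *\<^sub>R v) - f (x + t *\<^sub>R u) - (f (x + t *\<^sub>R v) - f x)
               - (t * t) *\<^sub>R blinfun_apply (G u) v)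
         \<le> 2 * \<epsilon> * (norm u + norm v)\<^sup>2 * (t * t)"
proof -
  define r where "r = t * (norm u + norm v)"
  define \<phi> where
    "\<phi> s = f (x + t *\<^sub>R u + s *\<^sub>R v) - f (x + s *\<^sub>R v) - (s * t) *\<^sub>R blinfun_apply (G u) v" for s
  define \<phi>' where
    "\<phi>' s = F (x + t *\<^sub>R u + s *\<^sub>R v) v - F (x + s *\<^sub>R v) v - t *\<^sub>R blinfun_apply (G u) v" for s
  have r: "norm (t *\<^sub>R u + s *\<^sub>R v) \<le> r" "norm (s *\<^sub>R v) \<le> r" if "s \<in> {0..t}" for s
  proof -
    have s: "s * norm v \<le> t * norm v" "0 \<le> s" using that by (auto intro: mult_right_mono)
    show "norm (s *\<^sub>R v) \<le> r" using s t(1) by (auto simp: r_def algebra_simps intro: add_increasing)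
    have "norm (t *\<^sub>R u + s *\<^sub>R v) \<le> t * norm u + s * norm v"
      using norm_triangle_ineq[of "t *\<^sub>R u" "s *\<^sub>R v"] s t(1) by simp
    then show "norm (t *\<^sub>R u + s *\<^sub>R v) \<le> r" using s by (simp add: r_def algebra_simps)
  qed
  have rd: "r < \<delta>" using t by (simp add: r_def)
  have der: "(\<phi> has_derivative (\<lambda>h. h *\<^sub>R \<phi>' s)) (at s within {0..t})" if s: "s \<in> {0..t}" for s
  proof -
    have n: "norm (x + t *\<^sub>R u + s *\<^sub>R v - x) < \<delta>" "norm (x + s *\<^sub>R v - x) < \<delta>"
      using r[OF s] rd by (auto simp: add.assoc)
    have 1: "((\<lambda>s. f (x + t *\<^sub>R u + s *\<^sub>R v)) has_derivative
        (\<lambda>h. F (x + t *\<^sub>R u + s *\<^sub>R v) (h *\<^sub>R v))) (at s within {0..t})"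
      by (rule has_derivative_compose[where f = "\<lambda>s. x + t *\<^sub>R u + s *\<^sub>R v", OF _ f[OF n(1)]]) (auto intro!: derivative_eq_intros)
    have 2: "((\<lambda>s. f (x + s *\<^sub>R v)) has_derivative
        (\<lambda>h. F (x + s *\<^sub>R v) (h *\<^sub>R v))) (at s within {0..t})"
      by (rule has_derivative_compose[where f = "\<lambda>s. x + s *\<^sub>R v", OF _ f[OF n(2)]]) (auto intro!: derivative_eq_intros)
    have 3: "((\<lambda>s. (s * t) *\<^sub>R blinfun_apply (G u) v) has_derivative
        (\<lambda>h. (h * t) *\<^sub>R blinfun_apply (G u) v)) (at s within {0..t})"
      by (auto intro!: derivative_eq_intros)
    show ?thesis
      unfolding \<phi>_def
      by (rule has_derivative_eq_rhs[OF has_derivative_diff[OF has_derivative_diff[OF 1 2] 3]])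
         (auto simp: \<phi>'_def fun_eq_iff blinfun.scaleR_right scaleR_diff_right)
  qed
  have bd: "onorm (\<lambda>h. h *\<^sub>R \<phi>' s) \<le> 2 * \<epsilon> * r * norm v" if s: "s \<in> {0..t}" for s
  proof -
    let ?a = "x + t *\<^sub>R u + s *\<^sub>R v" and ?b = "x + s *\<^sub>R v"
    have n: "norm (?a - x) < \<delta>" "norm (?b - x) < \<delta>" "norm (?a - x) \<le> r" "norm (?b - x) \<le> r"
      using r[OF s] rd by (auto simp: add.assoc)
    have 1: "norm (F ?a - F x - G (?a - x)) \<le> \<epsilon> * r"
      by (rule order_trans[OF F[OF n(1)] mult_left_mono[OF n(3) \<epsilon>]])
    have 2: "norm (F ?b - F x - G (?b - x)) \<le> \<epsilon> * r"
      by (rule order_trans[OF F[OF n(2)] mult_left_mono[OF n(4) \<epsilon>]])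
    have "?a - x = t *\<^sub>R u + s *\<^sub>R v" "?b - x = s *\<^sub>R v" by simp_all
    then have "G (?a - x) - G (?b - x) = t *\<^sub>R G u"
      by (simp only: linear_add[OF G] linear_scale[OF G]) simp
    then have eq: "F ?a - F ?b - t *\<^sub>R G u
        = (F ?a - F x - G (?a - x)) - (F ?b - F x - G (?b - x))"
      by (simp add: algebra_simps)
    have 3: "norm (F ?a - F ?b - t *\<^sub>R G u) \<le> \<epsilon> * r + \<epsilon> * r"
      unfolding eq by (rule order_trans[OF norm_triangle_ineq4 add_mono[OF 1 2]])
    have "\<phi>' s = (F ?a - F ?b - t *\<^sub>R G u) v"
      by (simp add: \<phi>'_def blinfun.diff_left blinfun.scaleR_left)
    then have "norm (\<phi>' s) \<le> norm (F ?a - F ?b - t *\<^sub>R G u) * norm v"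
      by (simp add: norm_blinfun)
    also have "\<dots> \<le> (\<epsilon> * r + \<epsilon> * r) * norm v" using 3 by (rule mult_right_mono) simp
    finally have "norm (\<phi>' s) \<le> 2 * \<epsilon> * r * norm v" by simp
    then show ?thesis
      by (intro onorm_le) (metis mult.commute mult_left_mono norm_ge_zero norm_scaleR real_norm_def)
  qed
  have "norm (\<phi> t - \<phi> 0) \<le> 2 * \<epsilon> * r * norm v * norm (t - 0)"
    by (rule differentiable_bound[OF _ der bd]) (use t in auto)
  also have "\<dots> \<le> 2 * \<epsilon> * r * (norm u + norm v) * t"
    using t \<epsilon> by (auto simp: r_def intro!: mult_right_mono mult_left_mono)
  also have "\<dots> = 2 * \<epsilon> * (norm u + norm v)\<^sup>2 * (t * t)"
    by (simp add: r_def power2_eq_square)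
  finally show ?thesis by (simp add: \<phi>_def algebra_simps)
qed

text \<open>
  For small \<open>t\<close> both \<open>t\<^sup>2 G u v\<close> and \<open>t\<^sup>2 G v u\<close> approximate the same second difference of \<open>f\<close> up to
  \<open>\<epsilon> t\<^sup>2\<close>, so they agree.
\<close>

lemma second_derivative_symmetric:
  fixes f :: "'a::real_normed_vector \<Rightarrow> 'b::real_normed_vector" and F :: "'a \<Rightarrow> 'a \<Rightarrow>\<^sub>L 'b"
  assumes S: "open S" "x \<in> S"
    and f: "\<And>y. y \<in> S \<Longrightarrow> (f has_derivative F y) (at y)"
    and F: "(F has_derivative G) (at x)"
  shows "blinfun_apply (G u) v = blinfun_apply (G v) u"
proof -
  define C where "C = 4 * (norm u + norm v)\<^sup>2"
  have lin: "linear G" using F by (rule has_derivative_linear)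
  have *: "norm (blinfun_apply (G u) v - blinfun_apply (G v) u) \<le> \<epsilon> * C" if \<epsilon>: "\<epsilon> > 0" for \<epsilon>
  proof -
    obtain d1 where d1: "d1 > 0" "\<And>y. norm (y - x) < d1 \<Longrightarrow> y \<in> S"
      using S by (metis open_dist dist_norm)
    obtain d2 where d2: "d2 > 0"
      "\<And>y. norm (y - x) < d2 \<Longrightarrow> norm (F y - F x - G (y - x)) \<le> \<epsilon> * norm (y - x)"
      using F \<epsilon> unfolding has_derivative_at_alt by blast
    define \<delta> where "\<delta> = min d1 d2"
    \<comment> \<open>The summand 1 covers \<open>u = v = 0\<close>.\<close>
    define t where "t = \<delta> / (norm u + norm v + 1)"
    have \<delta>: "\<delta> > 0" using d1 d2 by (simp add: \<delta>_def)
    have p: "norm u + norm v + 1 > 0" by (simp add: add_nonneg_pos)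
    have t: "t > 0" "t * (norm u + norm v) < \<delta>" "t * (norm v + norm u) < \<delta>"
      using \<delta> p by (auto simp: t_def field_simps)
    have f': "(f has_derivative F y) (at y)"
      and F': "norm (F y - F x - G (y - x)) \<le> \<epsilon> * norm (y - x)" if "norm (y - x) < \<delta>" for y
      using that d1 d2 f by (auto simp: \<delta>_def)
    define d where "d = f (x + t *\<^sub>R u + t *\<^sub>R v) - f (x + t *\<^sub>R u) - (f (x + t *\<^sub>R v) - f x)"
    have 1: "norm (d - (t * t) *\<^sub>R blinfun_apply (G u) v) \<le> 2 * \<epsilon> * (norm u + norm v)\<^sup>2 * (t * t)"
      unfolding d_def by (rule second_difference_bound[OF f' F' lin t(1,2)]) (use \<epsilon> in auto)
    have 2: "norm (d - (t * t) *\<^sub>R blinfun_apply (G v) u) \<le> 2 * \<epsilon> * (norm v + norm u)\<^sup>2 * (t * t)"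
      using second_difference_bound[OF f' F' lin t(1,3)] \<epsilon>
      by (simp add: d_def algebra_simps)
    have "norm ((t * t) *\<^sub>R (blinfun_apply (G u) v - blinfun_apply (G v) u)) \<le> \<epsilon> * C * (t * t)"
      using norm_triangle_ineq4[of "d - (t * t) *\<^sub>R blinfun_apply (G v) u"
          "d - (t * t) *\<^sub>R blinfun_apply (G u) v"] 1 2
      by (simp add: C_def algebra_simps)
    then show ?thesis using t(1) by (simp add: mult.commute)
  qed
  have "norm (blinfun_apply (G u) v - blinfun_apply (G v) u) \<le> 0 + e" if "e > 0" for e
  proof -
    have C: "C \<ge> 0" by (simp add: C_def)
    have "norm (blinfun_apply (G u) v - blinfun_apply (G v) u) \<le> e / (C + 1) * C"
      using *[of "e / (C + 1)"] that C by simp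
    also have "\<dots> \<le> e" using that C by (simp add: field_simps)
    finally show ?thesis by simp
  qed
  then have "norm (blinfun_apply (G u) v - blinfun_apply (G v) u) \<le> 0" by (rule field_le_epsilon)
  then show ?thesis by simp
qed

section \<open>Derivatives of smooth maps\<close>

lemma smooth_on_open: "smooth_on S f \<Longrightarrow> open S"
  by (simp add: smooth_on_def)

text \<open>
  The derivatives of order one and two, repackaged as bounded operators, so that product and chain
  rule apply to expressions such as \<open>F y (X y)\<close>. The
  second one is needed because brackets differentiate \<open>y \<mapsto> F y (X y)\<close>.
\<close>

lemma smooth_on_second_derivative:
  fixes f :: "'a::real_normed_vector \<Rightarrow> 'b::real_normed_vector"
  assumes "smooth_on S f" "x \<in> S"
  obtains F :: "'a \<Rightarrow> 'a \<Rightarrow>\<^sub>L 'b" and G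
  where "\<And>y. y \<in> S \<Longrightarrow> (f has_derivative F y) (at y)" "(F has_derivative G) (at x)"
proof -
  obtain D :: "nat \<Rightarrow> 'a \<Rightarrow> 'a list \<Rightarrow> 'b" where S: "open S"
    and D0: "\<And>x. x \<in> S \<Longrightarrow> D 0 x [] = f x"
    and ml: "\<And>n x. x \<in> S \<Longrightarrow> bounded_multilinear n (D n x)"
    and lim: "\<And>n x \<epsilon>. x \<in> S \<Longrightarrow> \<epsilon> > 0 \<Longrightarrow> \<forall>\<^sub>F y in at x. \<forall>vs. length vs = n \<longrightarrow>
           norm (D n y vs - D n x vs - D (Suc n) x ((y - x) # vs))
             \<le> \<epsilon> * norm (y - x) * prod_list (map norm vs)"
    using assms(1) unfolding smooth_on_def by blast
  have bl1: "bounded_linear (\<lambda>h. D 1 y [h])" if y: "y \<in> S" for y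
  proof -
    obtain K where K: "\<And>vs. length vs = 1 \<Longrightarrow> norm (D 1 y vs) \<le> K * prod_list (map norm vs)"
      and l: "\<And>us ws. length us + length ws + 1 = 1 \<Longrightarrow> linear (\<lambda>v. D 1 y (us @ v # ws))"
      using ml[OF y, of 1] unfolding bounded_multilinear_def by blast
    have "linear (\<lambda>h. D 1 y [h])" using l[of "[]" "[]"] by simp
    moreover have "norm (D 1 y [h]) \<le> norm h * K" for h
      using K[of "[h]"] by (simp add: mult.commute)
    ultimately show ?thesis
      unfolding bounded_linear_def bounded_linear_axioms_def by blast
  qed
  define F where "F y = Blinfun (\<lambda>h. D 1 y [h])" for y
  have F: "blinfun_apply (F y) h = D 1 y [h]" if "y \<in> S" for y h
    using bl1[OF that] by (simp add: F_def bounded_linear_Blinfun_apply)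
  obtain K where K: "\<And>vs. length vs = 2 \<Longrightarrow> norm (D 2 x vs) \<le> K * prod_list (map norm vs)"
    and l: "\<And>us ws. length us + length ws + 1 = 2 \<Longrightarrow> linear (\<lambda>v. D 2 x (us @ v # ws))"
    using ml[OF assms(2), of 2] unfolding bounded_multilinear_def by blast
  have K: "norm (D 2 x [h, k]) \<le> K * norm h * norm k" for h k
    using K[of "[h, k]"] by (simp add: mult.assoc)
  have l1: "linear (\<lambda>h. D 2 x [h, k])" for k using l[of "[]" "[k]"] by simp
  have l2: "linear (\<lambda>k. D 2 x [h, k])" for h using l[of "[h]" "[]"] by simp
  have bl2: "bounded_linear (\<lambda>k. D 2 x [h, k])" for h
    unfolding bounded_linear_def bounded_linear_axioms_def
    using l2[of h] K[of h] by (metis mult.commute)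
  define G where "G h = Blinfun (\<lambda>k. D 2 x [h, k])" for h
  have G: "blinfun_apply (G h) k = D 2 x [h, k]" for h k
    using bl2 by (simp add: G_def bounded_linear_Blinfun_apply)
  have blG: "bounded_linear G"
  proof (rule bounded_linear_intro[where K = "\<bar>K\<bar>"])
    show "G (h + h') = G h + G h'" for h h'
      by (rule blinfun_eqI) (simp add: G blinfun.add_left linear_add[OF l1])
    show "G (r *\<^sub>R h) = r *\<^sub>R G h" for r h
      by (rule blinfun_eqI) (simp add: G blinfun.scaleR_left linear_scale[OF l1])
    show "norm (G h) \<le> norm h * \<bar>K\<bar>" for h
    proof (rule norm_blinfun_bound)
      show "norm (blinfun_apply (G h) k) \<le> norm h * \<bar>K\<bar> * norm k" for k
        using K[of h k] mult_right_mono[OF abs_ge_self[of K], of "norm h * norm k"]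
        by (simp add: G algebra_simps)
    qed simp
  qed
  have f: "(f has_derivative F y) (at y)" if y: "y \<in> S" for y
    unfolding has_derivative_at_alt
  proof (intro conjI allI impI)
    fix \<epsilon> :: real assume "\<epsilon> > 0"
    have "\<forall>\<^sub>F z in at y. z \<in> S" using S y by (rule eventually_at_in_open')
    with lim[OF y \<open>\<epsilon> > 0\<close>, of 0] have "\<forall>\<^sub>F z in at y. norm (f z - f y - F y (z - y)) \<le> \<epsilon> * norm (z - y)"
      by eventually_elim (simp add: D0 y F)
    then obtain d where "d > 0"
      "\<And>z. z \<noteq> y \<Longrightarrow> norm (z - y) < d \<Longrightarrow> norm (f z - f y - F y (z - y)) \<le> \<epsilon> * norm (z - y)"
      unfolding eventually_at by (auto simp: dist_norm)
    then show "\<exists>d>0. \<forall>z. norm (z - y) < d \<longrightarrow> norm (f z - f y - F y (z - y)) \<le> \<epsilon> * norm (z - y)"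
      by (intro exI[of _ d]) (metis blinfun.zero_right diff_self mult_zero_right norm_zero order_refl)
  qed (rule blinfun.bounded_linear_right)
  have "(F has_derivative G) (at x)"
    unfolding has_derivative_at_alt
  proof (intro conjI allI impI)
    fix \<epsilon> :: real assume "\<epsilon> > 0"
    have "\<forall>\<^sub>F z in at x. z \<in> S" using S assms(2) by (rule eventually_at_in_open')
    with lim[OF assms(2) \<open>\<epsilon> > 0\<close>, of 1]
    have "\<forall>\<^sub>F z in at x. norm (F z - F x - G (z - x)) \<le> \<epsilon> * norm (z - x)"
    proof eventually_elim
      case (elim z)
      show ?case
      proof (rule norm_blinfun_bound)
        show "norm (blinfun_apply (F z - F x - G (z - x)) k) \<le> \<epsilon> * norm (z - x) * norm k" for k
          using elim(1)[rule_format, of "[k]"] elim(2) assms(2)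
          by (simp add: blinfun.diff_left F G numeral_2_eq_2)
      qed (use \<open>\<epsilon> > 0\<close> in simp)
    qed
    then obtain d where "d > 0"
      "\<And>z. z \<noteq> x \<Longrightarrow> norm (z - x) < d \<Longrightarrow> norm (F z - F x - G (z - x)) \<le> \<epsilon> * norm (z - x)"
      unfolding eventually_at by (auto simp: dist_norm)
    then show "\<exists>d>0. \<forall>z. norm (z - x) < d \<longrightarrow> norm (F z - F x - G (z - x)) \<le> \<epsilon> * norm (z - x)"
      by (intro exI[of _ d])
         (metis bounded_linear.linear[OF blG] linear_0 diff_self mult_zero_right norm_zero order_refl)
  qed (rule blG)
  with f show thesis by (rule that)
qed

lemma smooth_on_has_frechet_derivative:
  assumes "smooth_on S f" "x \<in> S"
  shows "(f has_derivative frechet_derivative f (at x)) (at x)"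
  by (rule smooth_on_second_derivative[OF assms])
     (metis assms(2) differentiableI frechet_derivative_works)

lemma frechet_derivative_cong_open:
  assumes "open S" "x \<in> S" "\<And>y. y \<in> S \<Longrightarrow> f y = g y"
  shows "frechet_derivative f (at x) = frechet_derivative g (at x)"
proof -
  have "(f has_derivative D) (at x) \<longleftrightarrow> (g has_derivative D) (at x)" for D
    by (metis assms has_derivative_transform_within_open)
  then show ?thesis by (simp add: frechet_derivative_def)
qed

section \<open>Brackets and torsion in a Banach space\<close>

definition lie_rep :: "('e::real_normed_vector \<Rightarrow> 'e) \<Rightarrow> ('e \<Rightarrow> 'e) \<Rightarrow> 'e \<Rightarrow> 'e" where
  "lie_rep X Y x = frechet_derivative X (at x) (Y x) - frechet_derivative Y (at x) (X x)"

text \<open>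
  The Nijenhuis torsion of \<open>v \<mapsto> n (x, v)\<close> as a bilinear expression in the values \<open>u\<close> and \<open>v\<close> of the two
  fields at \<open>x\<close>: in the usual notation
  \<open>n'(n v) u - n'(n u) v - n (n'(v) u - n'(u) v)\<close>, where \<open>n'(h) w\<close> differentiates \<open>n\<close> in the
  direction \<open>h\<close> of the base, with \<open>w\<close> held fixed.
\<close>

definition torsion_rep :: "('e \<times> 'e \<Rightarrow> 'e::real_normed_vector) \<Rightarrow> 'e \<Rightarrow> 'e \<Rightarrow> 'e \<Rightarrow> 'e" where
  "torsion_rep n x u v =
     (let d = (\<lambda>h w. frechet_derivative n (at (x, w)) (h, 0))
      in d (n (x, v)) u - d (n (x, u)) v - n (x, d v u - d u v))"

text \<open>
  Chain and product rule, applied to the two sides of \<open>X' (f y) = F y (X y)\<close>.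
\<close>

lemma related_fields_derivative:
  fixes f :: "'a::real_normed_vector \<Rightarrow> 'b::real_normed_vector" and F :: "'a \<Rightarrow> 'a \<Rightarrow>\<^sub>L 'b"
  assumes S: "open S" "x \<in> S"
    and f: "\<And>y. y \<in> S \<Longrightarrow> (f has_derivative F y) (at y)"
    and F: "(F has_derivative G) (at x)"
    and X: "X differentiable (at x)" and X': "X' differentiable (at (f x))"
    and rel: "\<And>y. y \<in> S \<Longrightarrow> X' (f y) = F y (X y)"
  shows "frechet_derivative X' (at (f x)) (F x h)
         = blinfun_apply (G h) (X x) + F x (frechet_derivative X (at x) h)"
proof -
  have 1: "((\<lambda>y. X' (f y)) has_derivative (\<lambda>h. frechet_derivative X' (at (f x)) (F x h))) (at x)"
    by (rule has_derivative_compose[OF f[OF S(2)]]) (use X' in \<open>simp add: frechet_derivative_works\<close>)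
  have "((\<lambda>y. F y (X y)) has_derivative
      (\<lambda>h. F x (frechet_derivative X (at x) h) + blinfun_apply (G h) (X x))) (at x)"
    by (rule bounded_bilinear.FDERIV[OF bounded_bilinear_blinfun_apply F])
       (use X in \<open>simp add: frechet_derivative_works\<close>)
  then have "((\<lambda>y. X' (f y)) has_derivative
      (\<lambda>h. F x (frechet_derivative X (at x) h) + blinfun_apply (G h) (X x))) (at x)"
    by (rule has_derivative_transform_within_open[OF _ S]) (simp add: rel)
  from fun_cong[OF has_derivative_unique[OF 1 this], of h] show ?thesis by (simp add: add.commute)
qed

text \<open>
  The terms \<open>G (Y x) (X x)\<close> and \<open>G (X x) (Y x)\<close> that the second derivative of \<open>f\<close> contributes to the
  two halves of the bracket cancel by symmetry. Applied to transition maps this makes the bracket of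
  vector fields on a manifold independent of the chart.
\<close>

lemma related_fields_bracket:
  fixes f :: "'a::real_normed_vector \<Rightarrow> 'b::real_normed_vector" and F :: "'a \<Rightarrow> 'a \<Rightarrow>\<^sub>L 'b"
  assumes S: "open S" "x \<in> S"
    and f: "\<And>y. y \<in> S \<Longrightarrow> (f has_derivative F y) (at y)"
    and F: "(F has_derivative G) (at x)"
    and X: "X differentiable (at x)" "X' differentiable (at (f x))"
      "\<And>y. y \<in> S \<Longrightarrow> X' (f y) = F y (X y)"
    and Y: "Y differentiable (at x)" "Y' differentiable (at (f x))"
      "\<And>y. y \<in> S \<Longrightarrow> Y' (f y) = F y (Y y)"
  shows "lie_rep X' Y' (f x) = F x (lie_rep X Y x)"
  using related_fields_derivative[OF S f F X, of "Y x"]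
    related_fields_derivative[OF S f F Y, of "X x"]
    second_derivative_symmetric[OF S f F, of "X x" "Y x"] S X(3) Y(3)
  by (simp add: lie_rep_def blinfun.diff_right)

lemma derivative_fibrewise_linear:
  fixes n :: "'a::real_normed_vector \<times> 'b::real_normed_vector \<Rightarrow> 'c::real_normed_vector"
  assumes n: "n differentiable (at (x, u))" and lin: "bounded_linear (\<lambda>v. n (x, v))"
  shows "frechet_derivative n (at (x, u)) (h, k) = frechet_derivative n (at (x, u)) (h, 0) + n (x, k)"
proof -
  \<comment> \<open>The restriction of \<open>n\<close> to the fibre over \<open>x\<close> is linear, hence its own derivative.\<close>
  let ?D = "frechet_derivative n (at (x, u))"
  have D: "(n has_derivative ?D) (at (x, u))" using n by (simp add: frechet_derivative_works)
  have "((\<lambda>v. n (x, v)) has_derivative (\<lambda>k. ?D (0, k))) (at u)"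
    by (rule has_derivative_compose[where f = "\<lambda>v. (x, v)", OF _ D]) (auto intro!: derivative_eq_intros)
  from has_derivative_unique[OF this bounded_linear_imp_has_derivative[OF lin]]
  have "?D (0, k) = n (x, k)" by (simp add: fun_eq_iff)
  moreover have "?D ((h, 0) + (0, k)) = ?D (h, 0) + ?D (0, k)"
    by (rule linear_add[OF has_derivative_linear[OF D]])
  ultimately show ?thesis by simp
qed

lemma has_derivative_fibrewise_linear_section:
  fixes n :: "'a::real_normed_vector \<times> 'b::real_normed_vector \<Rightarrow> 'c::real_normed_vector"
  assumes n: "n differentiable (at (x, X x))" and lin: "bounded_linear (\<lambda>v. n (x, v))"
    and X: "(X has_derivative X') (at x)"
  shows "((\<lambda>y. n (y, X y)) has_derivative
    (\<lambda>h. frechet_derivative n (at (x, X x)) (h, 0) + n (x, X' h))) (at x)"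
proof -
  have D: "(n has_derivative frechet_derivative n (at (x, X x))) (at (x, X x))"
    using n by (simp add: frechet_derivative_works)
  have "((\<lambda>y. n (y, X y)) has_derivative (\<lambda>h. frechet_derivative n (at (x, X x)) (h, X' h))) (at x)"
    by (rule has_derivative_compose[where f = "\<lambda>y. (y, X y)", OF _ D]) (auto intro!: derivative_eq_intros X)
  then show ?thesis
    by (simp add: derivative_fibrewise_linear[OF n lin, symmetric])
qed

text \<open>
  All derivatives of \<open>X\<close> and \<open>Y\<close> cancel, so the torsion at a point depends only on the values of the
  fields there. This tensoriality lets fields that are constant in a chart stand in for arbitrary ones.
\<close>

lemma torsion_rep_eq:
  fixes n :: "'e \<times> 'e \<Rightarrow> 'e::real_normed_vector"
  assumes n: "\<And>v. n differentiable (at (x, v))" and lin: "bounded_linear (\<lambda>v. n (x, v))"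
    and X: "X differentiable (at x)" and Y: "Y differentiable (at x)"
  defines "NX \<equiv> \<lambda>y. n (y, X y)" and "NY \<equiv> \<lambda>y. n (y, Y y)"
  shows "lie_rep NX NY x - n (x, lie_rep NX Y x + lie_rep X NY x - n (x, lie_rep X Y x))
    = torsion_rep n x (X x) (Y x)"
proof -
  have *: "frechet_derivative (\<lambda>y. n (y, Z y)) (at x) h
      = frechet_derivative n (at (x, Z x)) (h, 0) + n (x, frechet_derivative Z (at x) h)"
    if "Z differentiable (at x)" for Z h
    by (subst frechet_derivative_at[OF has_derivative_fibrewise_linear_section[where X = Z,
          OF n lin frechet_derivative_works[THEN iffD1, OF that]], symmetric]) simp
  note l = linear_diff[OF bounded_linear.linear[OF lin]] linear_add[OF bounded_linear.linear[OF lin]]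
  show ?thesis
    unfolding lie_rep_def NX_def NY_def *[OF X] *[OF Y] torsion_rep_def Let_def l
    by (simp add: algebra_simps)
qed

text \<open>
  The computation at the heart of the theorem. Differentiating the projectability condition
  \<open>n0 (f y, F y w) = F y (n (y, w))\<close> at \<open>x\<close> in the direction \<open>h\<close> gives
  \<open>F (n'(h) w) = n0'(F h) (F w) + n0 (G h w) - G h (n w)\<close>.
  Substituted in \<open>F (torsion_rep n x u v)\<close>, the terms with \<open>n0'\<close> form the torsion of \<open>n0\<close>, and the
  terms with the second derivative \<open>G\<close> of \<open>f\<close> cancel in pairs because \<open>G\<close> is symmetric.
\<close>

lemma torsion_rep_projects:
  fixes f :: "'a::real_normed_vector \<Rightarrow> 'b::real_normed_vector" and F :: "'a \<Rightarrow> 'a \<Rightarrow>\<^sub>L 'b"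
  assumes S: "open S" "x \<in> S"
    and f: "\<And>y. y \<in> S \<Longrightarrow> (f has_derivative F y) (at y)"
    and F: "(F has_derivative G) (at x)"
    and n: "\<And>v. n differentiable (at (x, v))"
    and n0: "\<And>w. n0 differentiable (at (f x, w))" and lin0: "bounded_linear (\<lambda>w. n0 (f x, w))"
    and proj: "\<And>y v. y \<in> S \<Longrightarrow> n0 (f y, F y v) = F y (n (y, v))"
  shows "F x (torsion_rep n x u v) = torsion_rep n0 (f x) (F x u) (F x v)"
proof -
  define d where "d h w = frechet_derivative n (at (x, w)) (h, 0)" for h w
  define d0 where "d0 h w = frechet_derivative n0 (at (f x, w)) (h, 0)" for h w
  have key: "F x (d h w) = d0 (F x h) (F x w) + n0 (f x, G h w) - blinfun_apply (G h) (n (x, w))"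
    for h w
  proof -
    have D: "(n has_derivative frechet_derivative n (at (x, w))) (at (x, w))"
      using n by (simp add: frechet_derivative_works)
    have D0: "(n0 has_derivative frechet_derivative n0 (at (f x, F x w))) (at (f x, F x w))"
      using n0 by (simp add: frechet_derivative_works)
    have Fw: "((\<lambda>y. F y w) has_derivative (\<lambda>h. G h w)) (at x)"
      by (rule bounded_linear.has_derivative[OF blinfun.bounded_linear_left F])
    have 1: "((\<lambda>y. n0 (f y, F y w)) has_derivative
        (\<lambda>h. frechet_derivative n0 (at (f x, F x w)) (F x h, G h w))) (at x)"
      by (rule has_derivative_compose[where f = "\<lambda>y. (f y, F y w)", OF _ D0]) (intro has_derivative_Pair f S Fw)
    have nw: "((\<lambda>y. n (y, w)) has_derivative (\<lambda>h. d h w)) (at x)"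
      unfolding d_def by (rule has_derivative_compose[where f = "\<lambda>y. (y, w)", OF _ D]) (auto intro!: derivative_eq_intros)
    have "((\<lambda>y. F y (n (y, w))) has_derivative
      (\<lambda>h. F x (d h w) + blinfun_apply (G h) (n (x, w)))) (at x)"
      by (rule bounded_bilinear.FDERIV[OF bounded_bilinear_blinfun_apply F nw])
    then have "((\<lambda>y. n0 (f y, F y w)) has_derivative
      (\<lambda>h. F x (d h w) + blinfun_apply (G h) (n (x, w)))) (at x)"
      by (rule has_derivative_transform_within_open[OF _ S]) (simp add: proj)
    from fun_cong[OF has_derivative_unique[OF 1 this], of h] show ?thesis
      using derivative_fibrewise_linear[OF n0 lin0, of "F x w" "F x h" "blinfun_apply (G h) w"]
      unfolding d0_def by (simp add: algebra_simps)
  qed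
  have l: "n0 (f x, a - b) = n0 (f x, a) - n0 (f x, b)" "n0 (f x, a + b) = n0 (f x, a) + n0 (f x, b)"
    for a b
    using linear_diff[OF bounded_linear.linear[OF lin0]] linear_add[OF bounded_linear.linear[OF lin0]]
    by auto
  have sym: "blinfun_apply (G h) k = blinfun_apply (G k) h" for h k
    by (rule second_derivative_symmetric[OF S f F])
  have "F x (torsion_rep n x u v)
    = F x (d (n (x, v)) u) - F x (d (n (x, u)) v) - n0 (f x, F x (d v u) - F x (d u v))"
    unfolding torsion_rep_def Let_def d_def[symmetric]
    by (simp add: blinfun.diff_right proj[OF S(2), symmetric])
  also have "\<dots> = d0 (n0 (f x, F x v)) (F x u) - d0 (n0 (f x, F x u)) (F x v)
      - n0 (f x, d0 (F x v) (F x u) - d0 (F x u) (F x v))"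
    by (simp add: key l proj[OF S(2)] sym[of "n (x, v)" u] sym[of "n (x, u)" v] sym[of u v]
        sym[of "n (x, v)" "n (x, u)"])
  finally show ?thesis
    unfolding torsion_rep_def Let_def d0_def .
qed

section \<open>Transition maps and tangent spaces\<close>

text \<open>
  Charts are pairs, but are treated as indivisible in all that follows.
\<close>

declare split_paired_Ex [simp del] split_paired_All [simp del]

context
  fixes A :: "('m, 'e::banach) chart set"
  assumes A: "banach_manifold A"
begin

lemma inv_coord_coord: "c \<in> A \<Longrightarrow> p \<in> chart_dom c \<Longrightarrow> inv_coord c (coord c p) = p"
  using A by (simp add: banach_manifold_def)

lemma open_coord_image: "c \<in> A \<Longrightarrow> open (coord c ` chart_dom c)"
  using A by (simp add: banach_manifold_def)

lemma transition_smooth: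
  "c \<in> A \<Longrightarrow> d \<in> A \<Longrightarrow> smooth_on (coord c ` (chart_dom c \<inter> chart_dom d)) (coord d \<circ> inv_coord c)"
  using A by (simp add: banach_manifold_def)

lemma open_coord_overlap:
  assumes "c \<in> A" "d \<in> A" "open (coord c ` (U \<inter> chart_dom c))"
  shows "open (coord c ` (U \<inter> chart_dom c \<inter> chart_dom d))"
proof -
  have "coord c ` (U \<inter> chart_dom c) \<inter> coord c ` (chart_dom c \<inter> chart_dom d)
      = coord c ` (U \<inter> chart_dom c \<inter> chart_dom d)"
    using assms(1) A unfolding banach_manifold_def by (auto dest!: inj_onD)
  moreover have "open (coord c ` (chart_dom c \<inter> chart_dom d))"
    using transition_smooth[OF assms(1,2)] by (rule smooth_on_open)
  ultimately show ?thesis using assms(3) by (metis open_Int)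
qed

lemma transition_has_derivative:
  assumes "c \<in> A" "d \<in> A" "p \<in> chart_dom c" "p \<in> chart_dom d"
  shows "((coord d \<circ> inv_coord c) has_derivative
    frechet_derivative (coord d \<circ> inv_coord c) (at (coord c p))) (at (coord c p))"
  by (rule smooth_on_has_frechet_derivative[OF transition_smooth]) (use assms in auto)

lemma transition_derivative_linear:
  assumes "c \<in> A" "d \<in> A" "p \<in> chart_dom c" "p \<in> chart_dom d"
  shows "linear (frechet_derivative (coord d \<circ> inv_coord c) (at (coord c p)))"
  by (rule has_derivative_linear[OF transition_has_derivative[OF assms]])

lemma transition_derivative_self:
  assumes "c \<in> A" "p \<in> chart_dom c"
  shows "frechet_derivative (coord c \<circ> inv_coord c) (at (coord c p)) v = v"
proof -
  have "frechet_derivative (coord c \<circ> inv_coord c) (at (coord c p))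
      = frechet_derivative (\<lambda>y. y) (at (coord c p))"
    by (rule frechet_derivative_cong_open[OF open_coord_image[OF assms(1)]])
       (use assms in \<open>auto simp: inv_coord_coord\<close>)
  then show ?thesis by simp
qed

lemma transition_derivative_comp:
  assumes "c \<in> A" "d \<in> A" "e \<in> A" "p \<in> chart_dom c" "p \<in> chart_dom d" "p \<in> chart_dom e"
  shows "frechet_derivative (coord e \<circ> inv_coord d) (at (coord d p))
      (frechet_derivative (coord d \<circ> inv_coord c) (at (coord c p)) v)
    = frechet_derivative (coord e \<circ> inv_coord c) (at (coord c p)) v"
proof -
  have dp: "(coord d \<circ> inv_coord c) (coord c p) = coord d p"
    using assms by (simp add: inv_coord_coord)
  have "((\<lambda>y. (coord e \<circ> inv_coord d) ((coord d \<circ> inv_coord c) y)) has_derivative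
      (\<lambda>v. frechet_derivative (coord e \<circ> inv_coord d) (at (coord d p))
        (frechet_derivative (coord d \<circ> inv_coord c) (at (coord c p)) v))) (at (coord c p))"
    by (rule has_derivative_compose[OF transition_has_derivative[of c d]])
       (use transition_has_derivative[of d e p, folded dp] assms dp in \<open>simp_all only:\<close>)
  moreover have "open (coord c ` (chart_dom c \<inter> chart_dom d))"
    using smooth_on_open transition_smooth assms by blast
  ultimately have "((coord e \<circ> inv_coord c) has_derivative
      (\<lambda>v. frechet_derivative (coord e \<circ> inv_coord d) (at (coord d p))
        (frechet_derivative (coord d \<circ> inv_coord c) (at (coord c p)) v))) (at (coord c p))"
    by (rule has_derivative_transform_within_open) (use assms in \<open>auto simp: inv_coord_coord\<close>)
  from frechet_derivative_at[OF this] show ?thesis by metis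
qed

lemma tangent_vec_eq:
  assumes "c \<in> A" "p \<in> chart_dom c"
  shows "tangent_vec A c p v =
    {(d, p, frechet_derivative (coord d \<circ> inv_coord c) (at (coord c p)) v) | d. d \<in> A \<and> p \<in> chart_dom d}"
  using assms by (auto simp: tangent_vec_def tangent_rel_def)

lemma component_family:
  assumes "c \<in> A" "p \<in> chart_dom c"
  shows "component c {(d, p, g d) | d. d \<in> A \<and> p \<in> chart_dom d} = g c"
  unfolding component_def using assms by auto

lemma component_tangent_vec:
  assumes "c \<in> A" "d \<in> A" "p \<in> chart_dom c" "p \<in> chart_dom d"
  shows "component d (tangent_vec A c p v)
    = frechet_derivative (coord d \<circ> inv_coord c) (at (coord c p)) v"
  using assms by (simp add: tangent_vec_eq component_family)

lemma component_tangent_vec_same: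
  assumes "c \<in> A" "p \<in> chart_dom c"
  shows "component c (tangent_vec A c p v) = v"
  using assms by (simp add: component_tangent_vec transition_derivative_self)

lemma tangent_vec_in_space:
  assumes "c \<in> A" "p \<in> chart_dom c"
  shows "tangent_vec A c p v \<in> tangent_space A p"
  using assms by (auto simp: tangent_space_def)

text \<open>
  The tangent vectors at \<open>p\<close> are exactly the families of components, one for each chart around \<open>p\<close>,
  that the derivatives of the transition maps take to each other. The operations on tangent vectors
  and the bracket are defined as families of components, and this is how they are recognised as
  tangent vectors again; only then is anything known about the value of an operator on them.
\<close>

lemma tangent_familyI:
  assumes p: "p \<in> points A"
    and g: "\<And>c d. \<lbrakk>c \<in> A; d \<in> A; p \<in> chart_dom c; p \<in> chart_dom d\<rbrakk> \<Longrightarrow>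
      g d = frechet_derivative (coord d \<circ> inv_coord c) (at (coord c p)) (g c)"
  shows "{(d, p, g d) | d. d \<in> A \<and> p \<in> chart_dom d} \<in> tangent_space A p"
proof -
  obtain c where c: "c \<in> A" "p \<in> chart_dom c" using p by (auto simp: points_def)
  have "{(d, p, g d) | d. d \<in> A \<and> p \<in> chart_dom d} = tangent_vec A c p (g c)"
    using g[OF c(1) _ c(2)] by (auto simp: tangent_vec_eq[OF c])
  then show ?thesis using tangent_vec_in_space[OF c] by simp
qed

lemma tangent_family:
  assumes "\<xi> \<in> tangent_space A p"
  shows "\<xi> = {(d, p, component d \<xi>) | d. d \<in> A \<and> p \<in> chart_dom d}"
proof -
  obtain c v where c: "c \<in> A" "p \<in> chart_dom c" and \<xi>: "\<xi> = tangent_vec A c p v"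
    using assms by (auto simp: tangent_space_def)
  show ?thesis
    unfolding \<xi> by (subst tangent_vec_eq[OF c]) (use c in \<open>auto simp: component_tangent_vec\<close>)
qed

lemma component_change:
  assumes "\<xi> \<in> tangent_space A p" "c \<in> A" "d \<in> A" "p \<in> chart_dom c" "p \<in> chart_dom d"
  shows "component d \<xi> = frechet_derivative (coord d \<circ> inv_coord c) (at (coord c p)) (component c \<xi>)"
proof -
  obtain e v where e: "e \<in> A" "p \<in> chart_dom e" and \<xi>: "\<xi> = tangent_vec A e p v"
    using assms by (auto simp: tangent_space_def)
  show ?thesis
    unfolding \<xi> using assms e by (simp add: component_tangent_vec transition_derivative_comp)
qed

lemma tangent_vec_component:
  assumes "\<xi> \<in> tangent_space A p" "c \<in> A" "p \<in> chart_dom c"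
  shows "tangent_vec A c p (component c \<xi>) = \<xi>"
  by (subst (2) tangent_family[OF assms(1)], subst tangent_vec_eq[OF assms(2,3)])
     (use component_change[OF assms(1,2) _ assms(3)] in auto)

lemma tangent_eqI:
  assumes "\<xi> \<in> tangent_space A p" "\<eta> \<in> tangent_space A p" "c \<in> A" "p \<in> chart_dom c"
    "component c \<xi> = component c \<eta>"
  shows "\<xi> = \<eta>"
  using assms tangent_vec_component by metis

lemma tangent_mem_iff:
  assumes "\<xi> \<in> tangent_space A p"
  shows "(c, q, v) \<in> \<xi> \<longleftrightarrow> c \<in> A \<and> p \<in> chart_dom c \<and> q = p \<and> v = component c \<xi>"
proof -
  have "(c, q, v) \<in> \<xi> \<longleftrightarrow> (c, q, v) \<in> {(d, p, component d \<xi>) | d. d \<in> A \<and> p \<in> chart_dom d}"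
    using tangent_family[OF assms] by simp
  then show ?thesis by auto
qed

lemma tangent_space_points: "\<xi> \<in> tangent_space A p \<Longrightarrow> p \<in> points A"
  by (auto simp: tangent_space_def points_def)

lemma base_point_eq:
  assumes "\<xi> \<in> tangent_space A p"
  shows "base_point \<xi> = p"
proof -
  obtain c where c: "c \<in> A" "p \<in> chart_dom c"
    using tangent_space_points[OF assms] by (auto simp: points_def)
  then show ?thesis
    unfolding base_point_def using tangent_mem_iff[OF assms] by blast
qed

lemma tv_add_in_space:
  assumes "\<xi> \<in> tangent_space A p" "\<eta> \<in> tangent_space A p"
  shows "tv_add \<xi> \<eta> \<in> tangent_space A p"
    and "c \<in> A \<Longrightarrow> p \<in> chart_dom c \<Longrightarrow> component c (tv_add \<xi> \<eta>) = component c \<xi> + component c \<eta>"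
proof -
  have eq: "tv_add \<xi> \<eta> = {(d, p, component d \<xi> + component d \<eta>) | d. d \<in> A \<and> p \<in> chart_dom d}"
    by (auto simp: tv_add_def tangent_mem_iff[OF assms(1)] tangent_mem_iff[OF assms(2)])
  show "tv_add \<xi> \<eta> \<in> tangent_space A p"
    unfolding eq
    by (rule tangent_familyI[OF tangent_space_points[OF assms(1)]])
       (simp add: linear_add[OF transition_derivative_linear] component_change[OF assms(1), symmetric]
          component_change[OF assms(2), symmetric])
  show "component c (tv_add \<xi> \<eta>) = component c \<xi> + component c \<eta>" if "c \<in> A" "p \<in> chart_dom c"
    unfolding eq using that by (rule component_family)
qed

lemma tv_diff_in_space:
  assumes "\<xi> \<in> tangent_space A p" "\<eta> \<in> tangent_space A p"
  shows "tv_diff \<xi> \<eta> \<in> tangent_space A p"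
    and "c \<in> A \<Longrightarrow> p \<in> chart_dom c \<Longrightarrow> component c (tv_diff \<xi> \<eta>) = component c \<xi> - component c \<eta>"
proof -
  have eq: "tv_diff \<xi> \<eta> = {(d, p, component d \<xi> - component d \<eta>) | d. d \<in> A \<and> p \<in> chart_dom d}"
    by (auto simp: tv_diff_def tangent_mem_iff[OF assms(1)] tangent_mem_iff[OF assms(2)])
  show "tv_diff \<xi> \<eta> \<in> tangent_space A p"
    unfolding eq
    by (rule tangent_familyI[OF tangent_space_points[OF assms(1)]])
       (simp add: linear_diff[OF transition_derivative_linear] component_change[OF assms(1), symmetric]
          component_change[OF assms(2), symmetric])
  show "component c (tv_diff \<xi> \<eta>) = component c \<xi> - component c \<eta>" if "c \<in> A" "p \<in> chart_dom c"
    unfolding eq using that by (rule component_family)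
qed

text \<open>
  A point \<open>(coord c p, v)\<close> in the range of a tangent chart comes from only one tangent vector, since the
  chart records both the base point and the component.
\<close>

lemma inv_coord_tangent_chart:
  assumes "c \<in> A" "p \<in> chart_dom c"
  shows "inv_coord (tangent_chart A c) (coord c p, v) = tangent_vec A c p v"
proof -
  have inj: "inj_on (coord c) (chart_dom c)" using A assms by (simp add: banach_manifold_def)
  have "inj_on (coord (tangent_chart A c)) (chart_dom (tangent_chart A c))"
  proof (rule inj_onI)
    fix \<xi> \<eta>
    assume "\<xi> \<in> chart_dom (tangent_chart A c)" "\<eta> \<in> chart_dom (tangent_chart A c)"
      and eq: "coord (tangent_chart A c) \<xi> = coord (tangent_chart A c) \<eta>"
    then obtain q r where q: "q \<in> chart_dom c" "\<xi> \<in> tangent_space A q"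
      and r: "r \<in> chart_dom c" "\<eta> \<in> tangent_space A r"
      by (auto simp: tangent_chart_def)
    have "coord c q = coord c r" "component c \<xi> = component c \<eta>"
      using eq base_point_eq q r by (auto simp: tangent_chart_def)
    then show "\<xi> = \<eta>" using tangent_eqI assms(1) q r inj by (metis inj_onD)
  qed
  moreover have "tangent_vec A c p v \<in> chart_dom (tangent_chart A c)"
    using assms tangent_vec_in_space[OF assms] by (auto simp: tangent_chart_def)
  moreover have "coord (tangent_chart A c) (tangent_vec A c p v) = (coord c p, v)"
    using assms base_point_eq[OF tangent_vec_in_space]
    by (auto simp: tangent_chart_def component_tangent_vec_same)
  ultimately show ?thesis by (metis inv_into_f_f)
qed

section \<open>Operators in charts\<close>

definition op_rep :: "('m, 'e) chart \<Rightarrow> (('m, 'e) tvec \<Rightarrow> ('m, 'e) tvec) \<Rightarrow> 'e \<times> 'e \<Rightarrow> 'e" where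
  "op_rep c N = (\<lambda>(x, v). component c (N (tangent_vec A c (inv_coord c x) v)))"

lemma op_rep_component:
  assumes "c \<in> A" "p \<in> chart_dom c" "\<xi> \<in> tangent_space A p"
  shows "op_rep c N (coord c p, component c \<xi>) = component c (N \<xi>)"
  using assms by (simp add: op_rep_def inv_coord_coord tangent_vec_component)

context
  fixes N
  assumes N: "N_operator A N"
begin

lemma N_operator_in_space: "\<xi> \<in> tangent_space A p \<Longrightarrow> N \<xi> \<in> tangent_space A p"
  using N tangent_space_points by (fastforce simp: N_operator_def)

lemma op_rep_linear:
  assumes "c \<in> A" "p \<in> chart_dom c"
  shows "bounded_linear (\<lambda>v. op_rep c N (coord c p, v))"
  using assms N by (simp add: op_rep_def inv_coord_coord N_operator_def)

text \<open>
  Smoothness of an operator \<open>N\<close> refers to the charts of the tangent bundle. There \<open>N\<close> is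
  \<open>(x, v) \<mapsto> (x, op_rep c N (x, v))\<close>, so the claim is about the second component.
\<close>

lemma op_rep_differentiable:
  assumes "c \<in> A" "p \<in> chart_dom c"
  shows "op_rep c N differentiable (at (coord c p, v))"
proof -
  let ?T = "tangent_chart A c"
  let ?W = "{\<xi> \<in> chart_dom ?T. N \<xi> \<in> chart_dom ?T}"
  have T: "?T \<in> tangent_atlas A" using assms by (simp add: tangent_atlas_def)
  have sm: "smooth_on (coord ?T ` ?W) (coord ?T \<circ> N \<circ> inv_coord ?T)"
    using conjunct2[OF bspec[OF bspec[OF conjunct2[OF conjunct1[OF N[unfolded N_operator_def],
      unfolded smooth_map_def]] T] T]] .
  have W: "\<xi> \<in> ?W" if "\<xi> \<in> tangent_space A q" "q \<in> chart_dom c" for \<xi> q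
    using that N_operator_in_space by (auto simp: tangent_chart_def)
  have coordT: "coord ?T \<xi> = (coord c q, component c \<xi>)" if "\<xi> \<in> tangent_space A q" for \<xi> q
    using base_point_eq[OF that] by (simp add: tangent_chart_def)
  have mem: "(coord c p, v) \<in> coord ?T ` ?W"
    using coordT[OF tangent_vec_in_space[OF assms], of v] W[OF tangent_vec_in_space[OF assms] assms(2), of v]
    by (metis (no_types, lifting) component_tangent_vec_same[OF assms] image_eqI)
  have "((\<lambda>z. snd ((coord ?T \<circ> N \<circ> inv_coord ?T) z)) has_derivative
      (\<lambda>h. snd (frechet_derivative (coord ?T \<circ> N \<circ> inv_coord ?T) (at (coord c p, v)) h))) (at (coord c p, v))"
    by (rule has_derivative_snd[OF smooth_on_has_frechet_derivative[OF sm mem]])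
  then have "(op_rep c N has_derivative
      (\<lambda>h. snd (frechet_derivative (coord ?T \<circ> N \<circ> inv_coord ?T) (at (coord c p, v)) h))) (at (coord c p, v))"
  proof (rule has_derivative_transform_within_open[OF _ smooth_on_open[OF sm] mem])
    fix z assume "z \<in> coord ?T ` ?W"
    then obtain \<xi> q where \<xi>: "\<xi> \<in> tangent_space A q" "q \<in> chart_dom c" "z = coord ?T \<xi>"
      by (auto simp: tangent_chart_def)
    then have "z = (coord c q, component c \<xi>)" using coordT by simp
    then show "snd ((coord ?T \<circ> N \<circ> inv_coord ?T) z) = op_rep c N z"
      using \<xi> assms(1)
      by (simp add: op_rep_component inv_coord_tangent_chart tangent_vec_component)
         (simp add: tangent_chart_def)
  qed
  then show ?thesis by (rule differentiableI)
qed

end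

section \<open>Vector fields, brackets and torsion on a manifold\<close>

text \<open>
  The regularity at \<open>p\<close> that the bracket formula demands, asked for in every chart around \<open>p\<close>. In this
  form it passes from \<open>X\<close> to \<open>N \<circ> X\<close> by the chain rule.
\<close>

definition field_differentiable_at :: "'m set \<Rightarrow> ('m \<Rightarrow> ('m, 'e) tvec) \<Rightarrow> 'm \<Rightarrow> bool" where
  "field_differentiable_at U X p \<longleftrightarrow>
     mfd_open A U \<and> p \<in> U \<and> (\<forall>q\<in>U. X q \<in> tangent_space A q) \<and>
     (\<forall>c\<in>A. p \<in> chart_dom c \<longrightarrow> local_rep c X differentiable (at (coord c p)))"

lemma local_rep_coord: "c \<in> A \<Longrightarrow> p \<in> chart_dom c \<Longrightarrow> local_rep c X (coord c p) = component c (X p)"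
  by (simp add: local_rep_def inv_coord_coord)

lemma local_rep_change:
  assumes "c \<in> A" "d \<in> A" "\<And>q. q \<in> U \<Longrightarrow> X q \<in> tangent_space A q"
    "y \<in> coord c ` (U \<inter> chart_dom c \<inter> chart_dom d)"
  shows "local_rep d X ((coord d \<circ> inv_coord c) y)
    = frechet_derivative (coord d \<circ> inv_coord c) (at y) (local_rep c X y)"
  using assms by (auto simp: inv_coord_coord local_rep_coord component_change)

text \<open>
  Differentiability in one chart \<open>c\<close> passes to any other chart \<open>d\<close>: the representative in \<open>d\<close> is
  \<open>y \<mapsto> F' (g y) (X\<^sub>c (g y))\<close>, where \<open>g\<close> is the transition map from \<open>d\<close> to \<open>c\<close>, \<open>F'\<close> is the derivative
  of its inverse and \<open>X\<^sub>c\<close> is the representative in \<open>c\<close>.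
\<close>

lemma local_vector_field_differentiable:
  assumes X: "local_vector_field A U X" and p: "p \<in> U"
  shows "field_differentiable_at U X p"
  unfolding field_differentiable_at_def
proof (intro conjI ballI impI)
  show "mfd_open A U" using X by (simp add: local_vector_field_def)
  show tan: "X q \<in> tangent_space A q" if "q \<in> U" for q
    using X that by (simp add: local_vector_field_def)
  show "p \<in> U" by (rule p)
  fix d assume d: "d \<in> A" "p \<in> chart_dom d"
  obtain c where c: "c \<in> A" "p \<in> chart_dom c" "smooth_on (coord c ` (U \<inter> chart_dom c)) (local_rep c X)"
    using X p by (auto simp: local_vector_field_def)
  let ?S = "coord d ` (U \<inter> chart_dom d \<inter> chart_dom c)"
  let ?g = "coord c \<circ> inv_coord d"
  have S: "open ?S" "coord d p \<in> ?S"
    using open_coord_overlap[OF d(1) c(1)] X d p c by (auto simp: local_vector_field_def mfd_open_def)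
  have gp: "?g (coord d p) = coord c p" using d by (simp add: inv_coord_coord)
  obtain F G where F: "\<And>y. y \<in> coord d ` (chart_dom d \<inter> chart_dom c) \<Longrightarrow> (?g has_derivative blinfun_apply (F y)) (at y)"
    and G: "(F has_derivative G) (at (coord d p))"
    by (rule smooth_on_second_derivative[OF transition_smooth[OF d(1) c(1)]]) (use c d in auto)
  obtain F' G' where F': "\<And>y. y \<in> coord c ` (chart_dom c \<inter> chart_dom d) \<Longrightarrow>
      ((coord d \<circ> inv_coord c) has_derivative blinfun_apply (F' y)) (at y)"
    and G': "(F' has_derivative G') (at (coord c p))"
    by (rule smooth_on_second_derivative[OF transition_smooth[OF c(1) d(1)]]) (use c d in auto)
  have g: "(?g has_derivative F (coord d p)) (at (coord d p))" using F c d by auto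
  have F'g: "((\<lambda>y. F' (?g y)) has_derivative (\<lambda>h. G' (F (coord d p) h))) (at (coord d p))"
    by (rule has_derivative_compose[OF g]) (use G' gp in simp)
  have "(local_rep c X has_derivative frechet_derivative (local_rep c X) (at (coord c p))) (at (coord c p))"
    by (rule smooth_on_has_frechet_derivative[OF c(3)]) (use c p in auto)
  then have Xg: "((\<lambda>y. local_rep c X (?g y)) has_derivative
      (\<lambda>h. frechet_derivative (local_rep c X) (at (coord c p)) (F (coord d p) h))) (at (coord d p))"
    by (intro has_derivative_compose[OF g]) (use gp in simp)
  note bounded_bilinear.FDERIV[OF bounded_bilinear_blinfun_apply F'g Xg]
  then have "(\<lambda>y. F' (?g y) (local_rep c X (?g y))) differentiable (at (coord d p))"
    by (rule differentiableI)
  moreover have "F' (?g y) (local_rep c X (?g y)) = local_rep d X y" if "y \<in> ?S" for y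
  proof -
    obtain q where q: "q \<in> U" "q \<in> chart_dom d" "q \<in> chart_dom c" "y = coord d q" using \<open>y \<in> ?S\<close> by auto
    have "blinfun_apply (F' (coord c q)) = frechet_derivative (coord d \<circ> inv_coord c) (at (coord c q))"
      by (rule frechet_derivative_at[OF F']) (use q in auto)
    then show ?thesis using q c d tan[OF q(1)] component_change[of "X q" q c d]
      by (simp add: inv_coord_coord local_rep_coord)
  qed
  ultimately show "local_rep d X differentiable (at (coord d p))"
    using S unfolding differentiable_def by (metis (no_types, lifting) has_derivative_transform_within_open)
qed

lemma N_operator_field_differentiable:
  assumes N: "N_operator A N" and X: "field_differentiable_at U X p"
  shows "field_differentiable_at U (N \<circ> X) p"
  unfolding field_differentiable_at_def
proof (intro conjI ballI impI)
  show "mfd_open A U" "p \<in> U" using X by (auto simp: field_differentiable_at_def)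
  show "(N \<circ> X) q \<in> tangent_space A q" if "q \<in> U" for q
    using X that N_operator_in_space[OF N] by (auto simp: field_differentiable_at_def)
  fix c assume c: "c \<in> A" "p \<in> chart_dom c"
  have "(\<lambda>y. op_rep c N (y, local_rep c X y)) differentiable (at (coord c p))"
    by (rule differentiableI[OF has_derivative_fibrewise_linear_section[OF op_rep_differentiable[OF N c]
        op_rep_linear[OF N c]]])
       (use X c in \<open>auto simp: field_differentiable_at_def frechet_derivative_works\<close>)
  moreover have "open (coord c ` (U \<inter> chart_dom c))" "coord c p \<in> coord c ` (U \<inter> chart_dom c)"
    using X c by (auto simp: field_differentiable_at_def mfd_open_def)
  moreover have "op_rep c N (y, local_rep c X y) = local_rep c (N \<circ> X) y"
    if "y \<in> coord c ` (U \<inter> chart_dom c)" for y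
    using that X c by (auto simp: field_differentiable_at_def local_rep_coord op_rep_component)
  ultimately show "local_rep c (N \<circ> X) differentiable (at (coord c p))"
    unfolding differentiable_def by (metis (no_types, lifting) has_derivative_transform_within_open)
qed

lemma component_lie_bracket:
  assumes "c \<in> A" "p \<in> chart_dom c"
  shows "component c (lie_bracket A X Y p) = lie_rep (local_rep c X) (local_rep c Y) (coord c p)"
  unfolding lie_bracket_def lie_rep_def using assms by (rule component_family)

lemma lie_bracket_in_space:
  assumes X: "field_differentiable_at U X p" and Y: "field_differentiable_at U Y p"
  shows "lie_bracket A X Y p \<in> tangent_space A p"
  unfolding lie_bracket_def lie_rep_def[symmetric]
proof (rule tangent_familyI)
  show "p \<in> points A" using X by (auto simp: field_differentiable_at_def mfd_open_def)
  fix c d assume cd: "c \<in> A" "d \<in> A" "p \<in> chart_dom c" "p \<in> chart_dom d"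
  let ?S = "coord c ` (U \<inter> chart_dom c \<inter> chart_dom d)"
  let ?f = "coord d \<circ> inv_coord c"
  obtain F G where F: "\<And>y. y \<in> coord c ` (chart_dom c \<inter> chart_dom d) \<Longrightarrow> (?f has_derivative blinfun_apply (F y)) (at y)"
    and G: "(F has_derivative G) (at (coord c p))"
    by (rule smooth_on_second_derivative[OF transition_smooth[OF cd(1,2)]]) (use cd in auto)
  have F': "(?f has_derivative blinfun_apply (F y)) (at y)" if "y \<in> ?S" for y using F that by auto
  have S: "open ?S" "coord c p \<in> ?S"
    using open_coord_overlap[OF cd(1,2)] X cd by (auto simp: field_differentiable_at_def mfd_open_def)
  have fp: "?f (coord c p) = coord d p" using cd by (simp add: inv_coord_coord)
  have rel: "local_rep d Z (?f y) = F y (local_rep c Z y)"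
    if Z: "field_differentiable_at U Z p" and y: "y \<in> ?S" for Z y
    using local_rep_change[OF cd(1,2) _ y, of Z] frechet_derivative_at[OF F'[OF y]] Z
    by (simp add: field_differentiable_at_def)
  have dif: "local_rep c Z differentiable (at (coord c p))"
      "local_rep d Z differentiable (at (?f (coord c p)))"
    if Z: "field_differentiable_at U Z p" for Z
    using Z cd fp by (auto simp: field_differentiable_at_def)
  show "lie_rep (local_rep d X) (local_rep d Y) (coord d p)
    = frechet_derivative ?f (at (coord c p)) (lie_rep (local_rep c X) (local_rep c Y) (coord c p))"
    using related_fields_bracket[OF S F' G dif[OF X] rel[OF X] dif[OF Y] rel[OF Y]]
      frechet_derivative_at[OF F'[OF S(2)]] fp by simp
qed

text \<open>
  Each of the brackets, sums and values of \<open>N\<close> that make up the torsion is a tangent vector at \<open>p\<close>, so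
  its component in a chart follows the local formula, which \<open>torsion_rep_eq\<close> evaluates.
\<close>

lemma torsion_in_chart:
  assumes N: "N_operator A N"
    and X: "field_differentiable_at U X p" and Y: "field_differentiable_at U Y p"
  shows "nijenhuis_torsion A N X Y p \<in> tangent_space A p"
    and "c \<in> A \<Longrightarrow> p \<in> chart_dom c \<Longrightarrow> component c (nijenhuis_torsion A N X Y p)
      = torsion_rep (op_rep c N) (coord c p) (component c (X p)) (component c (Y p))"
proof -
  note NX = N_operator_field_differentiable[OF N X] and NY = N_operator_field_differentiable[OF N Y]
  note br = lie_bracket_in_space[OF NX NY] lie_bracket_in_space[OF NX Y]
    lie_bracket_in_space[OF X NY] lie_bracket_in_space[OF X Y]
  note Nb = N_operator_in_space[OF N br(4)]
  note add = tv_add_in_space[OF br(2,3)]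
  note diff = tv_diff_in_space[OF add(1) Nb]
  note N2 = N_operator_in_space[OF N diff(1)]
  show "nijenhuis_torsion A N X Y p \<in> tangent_space A p"
    unfolding nijenhuis_torsion_def by (rule tv_diff_in_space(1)[OF br(1) N2])
  assume c: "c \<in> A" "p \<in> chart_dom c"
  let ?x = "coord c p" and ?n = "op_rep c N" and ?X = "local_rep c X" and ?Y = "local_rep c Y"
  have S: "open (coord c ` (U \<inter> chart_dom c))" "?x \<in> coord c ` (U \<inter> chart_dom c)"
    using X c by (auto simp: field_differentiable_at_def mfd_open_def)
  have rep: "local_rep c (N \<circ> Z) y = ?n (y, local_rep c Z y)"
    if "field_differentiable_at U Z p" "y \<in> coord c ` (U \<inter> chart_dom c)" for Z y
    using that c by (auto simp: field_differentiable_at_def local_rep_coord op_rep_component)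
  have der: "frechet_derivative (local_rep c (N \<circ> Z)) (at ?x)
      = frechet_derivative (\<lambda>y. ?n (y, local_rep c Z y)) (at ?x)"
    if "field_differentiable_at U Z p" for Z
    by (rule frechet_derivative_cong_open[OF S rep[OF that]])
  have "component c (nijenhuis_torsion A N X Y p) =
      lie_rep (local_rep c (N \<circ> X)) (local_rep c (N \<circ> Y)) ?x -
      ?n (?x, lie_rep (local_rep c (N \<circ> X)) ?Y ?x + lie_rep ?X (local_rep c (N \<circ> Y)) ?x
              - ?n (?x, lie_rep ?X ?Y ?x))"
    unfolding nijenhuis_torsion_def tv_diff_in_space(2)[OF br(1) N2 c]
      op_rep_component[OF c diff(1), symmetric] diff(2)[OF c] add(2)[OF c]
      op_rep_component[OF c br(4), symmetric] component_lie_bracket[OF c] ..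
  also have "\<dots> = torsion_rep ?n ?x (?X ?x) (?Y ?x)"
    using torsion_rep_eq[OF op_rep_differentiable[OF N c] op_rep_linear[OF N c], of ?X ?Y] X Y c
    unfolding lie_rep_def der[OF X] der[OF Y] rep[OF X S(2)] rep[OF Y S(2)]
    by (simp add: field_differentiable_at_def)
  finally show "component c (nijenhuis_torsion A N X Y p)
      = torsion_rep ?n ?x (component c (X p)) (component c (Y p))"
    using c by (simp add: local_rep_coord)
qed

text \<open>
  Every tangent vector at a point of \<open>chart_dom c\<close> is a value of such a field, so it extends to a local
  vector field.
\<close>

lemma constant_field:
  assumes c: "c \<in> A"
  shows "local_vector_field A (chart_dom c) (\<lambda>p. tangent_vec A c p v)"
  unfolding local_vector_field_def
proof (intro conjI ballI)
  have "open (coord d ` (chart_dom c \<inter> chart_dom d))" if "d \<in> A" for d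
    using smooth_on_open[OF transition_smooth[OF that c]] by (simp add: Int_commute)
  then show "mfd_open A (chart_dom c)"
    using c by (auto simp: mfd_open_def points_def)
  show "tangent_vec A c p v \<in> tangent_space A p" if "p \<in> chart_dom c" for p
    using c that by (rule tangent_vec_in_space)
  let ?S = "coord c ` (chart_dom c \<inter> chart_dom c)"
  have "smooth_on ?S (local_rep c (\<lambda>p. tangent_vec A c p v))"
    unfolding smooth_on_def
  proof (intro conjI exI[of _ "\<lambda>n x vs. if n = 0 then v else 0"] allI ballI impI)
    show "open ?S" using open_coord_image[OF c] by simp
    show "(if (0::nat) = 0 then v else 0) = local_rep c (\<lambda>p. tangent_vec A c p v) x" if "x \<in> ?S" for x
      using that c by (auto simp: local_rep_coord component_tangent_vec_same)
    show "bounded_multilinear n (\<lambda>vs. if n = 0 then v else 0)" for n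
      unfolding bounded_multilinear_def by (auto simp: linear_zero intro!: exI[of _ "norm v"] mult_nonneg_nonneg prod_list_nonneg)
  qed (auto intro!: always_eventually prod_list_nonneg mult_nonneg_nonneg)
  then show "\<exists>d\<in>A. p \<in> chart_dom d \<and>
      smooth_on (coord d ` (chart_dom c \<inter> chart_dom d)) (local_rep d (\<lambda>p. tangent_vec A c p v))"
    if "p \<in> chart_dom c" for p
    using c that by blast
qed

end

section \<open>Projection of the torsion along a fibration\<close>

context
  fixes A :: "('m, 'e::banach) chart set" and B :: "('n, 'f::banach) chart set" and \<tau> :: "'m \<Rightarrow> 'n"
  assumes A: "banach_manifold A" and B: "banach_manifold B" and fib: "fibration A B \<tau>"
begin

lemma tangent_map_in_space:
  assumes "\<xi> \<in> tangent_space A p"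
  shows "tangent_map B \<tau> \<xi> \<in> tangent_space B (\<tau> p)"
  using fib tangent_space_points[OF A assms] assms by (auto simp: fibration_def)

text \<open>
  The definition of \<open>tangent_map\<close> collects the images computed in all charts around \<open>p\<close>. That these
  agree is already contained in the fact that a fibration maps tangent spaces to tangent spaces.
\<close>

lemma component_tangent_map:
  assumes \<xi>: "\<xi> \<in> tangent_space A p" and c: "c \<in> A" "p \<in> chart_dom c"
    and d: "d \<in> B" "\<tau> p \<in> chart_dom d"
  shows "component d (tangent_map B \<tau> \<xi>)
    = frechet_derivative (coord d \<circ> \<tau> \<circ> inv_coord c) (at (coord c p)) (component c \<xi>)"
proof -
  have "(c, p, component c \<xi>) \<in> \<xi>" using c by (simp add: tangent_mem_iff[OF A \<xi>])
  then have "(d, \<tau> p, frechet_derivative (coord d \<circ> \<tau> \<circ> inv_coord c) (at (coord c p)) (component c \<xi>))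
      \<in> tangent_map B \<tau> \<xi>"
    using d unfolding tangent_map_def by blast
  then show ?thesis by (simp add: tangent_mem_iff[OF B tangent_map_in_space[OF \<xi>]])
qed

text \<open>
  The torsions of \<open>N\<close> and \<open>N0\<close> are related by the tangent map. The fields \<open>X\<close> and \<open>X0\<close> have to be
  related at the single point \<open>p\<close> only, and likewise \<open>Y\<close> and \<open>Y0\<close>, by the tensoriality of both torsions.
\<close>

lemma torsion_projects:
  assumes N: "N_operator A N" and N0: "N_operator B N0" and proj: "projectable A B \<tau> N N0"
    and X: "field_differentiable_at A U X p" and Y: "field_differentiable_at A U Y p"
    and X0: "field_differentiable_at B V X0 (\<tau> p)" and Y0: "field_differentiable_at B V Y0 (\<tau> p)"
    and XX0: "tangent_map B \<tau> (X p) = X0 (\<tau> p)" and YY0: "tangent_map B \<tau> (Y p) = Y0 (\<tau> p)"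
  shows "tangent_map B \<tau> (nijenhuis_torsion A N X Y p) = nijenhuis_torsion B N0 X0 Y0 (\<tau> p)"
proof -
  have "p \<in> points A" "\<tau> p \<in> points B"
    using X X0 by (auto simp: field_differentiable_at_def[OF A] field_differentiable_at_def[OF B] mfd_open_def)
  then obtain c d where c: "c \<in> A" "p \<in> chart_dom c" and d: "d \<in> B" "\<tau> p \<in> chart_dom d"
    by (auto simp: points_def)
  let ?f = "coord d \<circ> \<tau> \<circ> inv_coord c"
  let ?S = "coord c ` {q \<in> chart_dom c. \<tau> q \<in> chart_dom d}"
  have S: "open ?S" "coord c p \<in> ?S" and sm: "smooth_on ?S ?f"
    using fib c d by (auto simp: fibration_def smooth_map_def)
  obtain F G where F: "\<And>y. y \<in> ?S \<Longrightarrow> (?f has_derivative blinfun_apply (F y)) (at y)"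
    and G: "(F has_derivative G) (at (coord c p))"
    using smooth_on_second_derivative[OF sm S(2)] by blast
  have fp: "?f (coord c p) = coord d (\<tau> p)" using c by (simp add: inv_coord_coord[OF A])
  have comp: "component d (tangent_map B \<tau> \<xi>) = F (coord c q) (component c \<xi>)"
    if "\<xi> \<in> tangent_space A q" "q \<in> chart_dom c" "\<tau> q \<in> chart_dom d" for \<xi> q
    using component_tangent_map[OF that(1) c(1) that(2) d(1) that(3)]
      frechet_derivative_at[OF F, of "coord c q"] that by auto
  have pr: "op_rep B d N0 (?f y, F y v) = F y (op_rep A c N (y, v))" if y: "y \<in> ?S" for y v
  proof -
    obtain q where q: "q \<in> chart_dom c" "\<tau> q \<in> chart_dom d" "y = coord c q" using y by auto
    let ?\<xi> = "tangent_vec A c q v"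
    have \<xi>: "?\<xi> \<in> tangent_space A q" by (rule tangent_vec_in_space[OF A c(1) q(1)])
    have v: "component c ?\<xi> = v" by (rule component_tangent_vec_same[OF A c(1) q(1)])
    have "?\<xi> \<in> tangent_bundle A" using \<xi> tangent_space_points[OF A \<xi>] by (auto simp: tangent_bundle_def)
    then have "component d (N0 (tangent_map B \<tau> ?\<xi>)) = component d (tangent_map B \<tau> (N ?\<xi>))"
      using proj by (simp add: projectable_def)
    then show ?thesis
      using comp[OF \<xi> q(1,2)] comp[OF N_operator_in_space[OF A N \<xi>] q(1,2)]
        op_rep_component[OF A c(1) q(1) \<xi>, of N]
        op_rep_component[OF B d(1) q(2) tangent_map_in_space[OF \<xi>], of N0] q(1,3) c(1) v
      by (simp add: inv_coord_coord[OF A])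
  qed
  note tX = torsion_in_chart[OF A N X Y] and tX0 = torsion_in_chart[OF B N0 X0 Y0]
  have "X p \<in> tangent_space A p" "Y p \<in> tangent_space A p"
    using X Y by (auto simp: field_differentiable_at_def[OF A])
  note XY = this[THEN comp[OF _ c(2) d(2)]]
  have "component d (tangent_map B \<tau> (nijenhuis_torsion A N X Y p))
      = component d (nijenhuis_torsion B N0 X0 Y0 (\<tau> p))"
    unfolding comp[OF tX(1) c(2) d(2)] tX(2)[OF c] tX0(2)[OF d] XX0[symmetric] YY0[symmetric] XY
    unfolding fp[symmetric]
  proof (rule torsion_rep_projects[OF S F G _ _ _ pr])
    show "op_rep A c N differentiable at (coord c p, v)" for v
      by (rule op_rep_differentiable[OF A N c])
    show "op_rep B d N0 differentiable at (?f (coord c p), w)" for w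
      unfolding fp by (rule op_rep_differentiable[OF B N0 d])
    show "bounded_linear (\<lambda>w. op_rep B d N0 (?f (coord c p), w))"
      unfolding fp by (rule op_rep_linear[OF B N0 d])
  qed
  then show ?thesis
    by (rule tangent_eqI[OF B tangent_map_in_space[OF tX(1)] tX0(1) d])
qed

end

theorem theorem4p1:
  fixes A :: "('m, 'e::banach) chart set" and B :: "('n, 'f::banach) chart set"
    and \<tau> :: "'m \<Rightarrow> 'n"
    and N :: "('m, 'e) tvec \<Rightarrow> ('m, 'e) tvec" and N\<^sub>0 :: "('n, 'f) tvec \<Rightarrow> ('n, 'f) tvec"
  assumes "banach_manifold A" and "banach_manifold B"
    and "fibration A B \<tau>"
    and "N_operator A N" and "N_operator B N\<^sub>0"
    and "projectable A B \<tau> N N\<^sub>0"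
  shows "nijenhuis_operator B N\<^sub>0 \<longleftrightarrow> vertical_torsion A B \<tau> N"
proof
  note A = assms(1) and B = assms(2) and N = assms(4) and N0 = assms(5)
  note project = torsion_projects[OF A B assms(3-6)]
  note diff_A = local_vector_field_differentiable[OF A] and diff_B = local_vector_field_differentiable[OF B]
  note const_A = constant_field[OF A] and const_B = constant_field[OF B]
  show "vertical_torsion A B \<tau> N" if nij: "nijenhuis_operator B N\<^sub>0"
    unfolding vertical_torsion_def
  proof (intro allI impI ballI)
    fix U X Y p assume "local_vector_field A U X \<and> local_vector_field A U Y" and p: "p \<in> U"
    then have X: "field_differentiable_at A U X p" and Y: "field_differentiable_at A U Y p"
      using diff_A by auto
    have pA: "p \<in> points A" using X by (auto simp: field_differentiable_at_def[OF A] mfd_open_def)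
    then have "\<tau> p \<in> points B" using assms(3) by (auto simp: fibration_def)
    then obtain d where d: "d \<in> B" "\<tau> p \<in> chart_dom d" by (auto simp: points_def)
    \<comment> \<open>Fields on the base with the values \<open>T\<tau> (X p)\<close> and \<open>T\<tau> (Y p)\<close> at \<open>\<tau> p\<close>.\<close>
    define ext where "ext \<xi> = (\<lambda>q. tangent_vec B d q (component d (tangent_map B \<tau> \<xi>)))" for \<xi> :: "('m, 'e) tvec"
    have ext: "local_vector_field B (chart_dom d) (ext \<xi>)" for \<xi>
      unfolding ext_def by (rule const_B[OF d(1)])
    have val: "tangent_map B \<tau> \<xi> = ext \<xi> (\<tau> p)" if "\<xi> \<in> tangent_space A p" for \<xi>
      unfolding ext_def
      using tangent_vec_component[OF B tangent_map_in_space[OF A B assms(3) that] d] by simp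
    have XY: "X p \<in> tangent_space A p" "Y p \<in> tangent_space A p"
      using X Y by (auto simp: field_differentiable_at_def[OF A])
    let ?T = "nijenhuis_torsion A N X Y p"
    have T: "?T \<in> tangent_space A p" by (rule torsion_in_chart(1)[OF A N X Y])
    have "tangent_map B \<tau> ?T = nijenhuis_torsion B N\<^sub>0 (ext (X p)) (ext (Y p)) (\<tau> p)"
      by (rule project[OF X Y diff_B[OF ext d(2)] diff_B[OF ext d(2)] val[OF XY(1)] val[OF XY(2)]])
    also have "\<dots> = tv_zero B (\<tau> p)"
      using nij ext d(2) unfolding nijenhuis_operator_def by blast
    finally show "?T \<in> vertical_bundle A B \<tau>"
      using T pA by (auto simp: vertical_bundle_def tangent_bundle_def base_point_eq[OF A T])
  qed
  show "nijenhuis_operator B N\<^sub>0" if vert: "vertical_torsion A B \<tau> N"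
    unfolding nijenhuis_operator_def
  proof (intro conjI allI impI ballI N0)
    fix V X0 Y0 q assume "local_vector_field B V X0 \<and> local_vector_field B V Y0" and q: "q \<in> V"
    then have X0: "field_differentiable_at B V X0 q" and Y0: "field_differentiable_at B V Y0 q"
      using diff_B by auto
    have "q \<in> points B" and XY0: "X0 q \<in> tangent_space B q" "Y0 q \<in> tangent_space B q"
      using X0 Y0 by (auto simp: field_differentiable_at_def[OF B] mfd_open_def)
    moreover have "\<tau> ` points A = points B" using assms(3) by (simp add: fibration_def)
    ultimately obtain p where p: "p \<in> points A" "q = \<tau> p" by blast
    then obtain c where c: "c \<in> A" "p \<in> chart_dom c" by (auto simp: points_def)
    have surj: "tangent_map B \<tau> ` tangent_space A p = tangent_space B q"
      using assms(3) p by (auto simp: fibration_def)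
    \<comment> \<open>Preimages of the two values exist because \<open>T\<tau>\<close> is onto at \<open>p\<close>; the fields themselves are not lifted.\<close>
    obtain \<xi> where \<xi>: "\<xi> \<in> tangent_space A p" "tangent_map B \<tau> \<xi> = X0 q"
      using surj XY0(1) by (metis imageE)
    obtain \<eta> where \<eta>: "\<eta> \<in> tangent_space A p" "tangent_map B \<tau> \<eta> = Y0 q"
      using surj XY0(2) by (metis imageE)
    define X where "X = (\<lambda>q. tangent_vec A c q (component c \<xi>))"
    define Y where "Y = (\<lambda>q. tangent_vec A c q (component c \<eta>))"
    have loc: "local_vector_field A (chart_dom c) X" "local_vector_field A (chart_dom c) Y"
      unfolding X_def Y_def by (rule const_A[OF c(1)])+
    have XY: "X p = \<xi>" "Y p = \<eta>"
      unfolding X_def Y_def using tangent_vec_component[OF A] \<xi> \<eta> c by auto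
    let ?T = "nijenhuis_torsion A N X Y p"
    note dif = diff_A[OF loc(1) c(2)] diff_A[OF loc(2) c(2)]
    have "nijenhuis_torsion B N\<^sub>0 X0 Y0 q = tangent_map B \<tau> ?T"
      using project[OF dif X0[unfolded p] Y0[unfolded p]] XY \<xi> \<eta> p by simp
    also have "\<dots> = tv_zero B (\<tau> (base_point ?T))"
      using vert loc c(2) unfolding vertical_torsion_def vertical_bundle_def by blast
    also have "base_point ?T = p" by (rule base_point_eq[OF A torsion_in_chart(1)[OF A N dif]])
    finally show "nijenhuis_torsion B N\<^sub>0 X0 Y0 q = tv_zero B q" using p by simp
  qed
qed

end
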